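(* Let $\alpha\in\mathbb{C}\setminus\{-1,-2,\dots\}$, let $k\in\{0,1,2,\dots\}$, let $u\in\mathbb{C}\setminus\{0,\pm s_1,\pm s_2,\dots\}$ and let $l\in\mathbb{Z}\setminus\{0\}$. Put $$\eta_{k,u}=\sum_{j\in\mathbb{Z}\setminus\{0\}}\frac{1}{(s_j-u)^{k+1}},\qquad \eta_k^{\{l\}}=\sum_{j\in\mathbb{Z}\setminus\{0,l\}}\frac{1}{(s_j-s_l)^{k+1}}.$$ Then $$\eta_{k,u}=2(1+\alpha)\left(\frac{(-1)^k}{u^{k+1}}-i^{k+1}\mathfrak{a}_{k,\alpha,iu}\right).$$ Moreover, the following recurrence relations hold: $$\sum_{j=0}^k\frac{\mathcal{I}_\alpha^{(k-j+1)}(iu)}{i^{j+1}(k-j)!}\left(\eta_{j,u}-\frac{(-1)^j2(1+\alpha)}{u^{j+1}}\right)=-\frac{\mathcal{I}_\alpha^{(k)}(iu)}{k!},$$ $$\sum_{j=0}^k\frac{\mathcal{I}_\alpha^{(k-j+1)}(is_l)}{i^{j+1}(k-j)!}\left(\eta_j^{\{l\}}-\frac{(-1)^j2(1+\alpha)}{s_l^{j+1}}\right)=\frac{\mathcal{I}_\alpha^{(k+2)}(is_l)}{(k+1)!}-\frac{\mathcal{I}_\alpha^{(k)}(is_l)}{k!}.$$ In particular, $$\eta_0^{\{l\}}=\frac{3+2\alpha}{2s_l},\qquad \eta_1^{\{l\}}=-\frac{(3+2\alpha)(7+2\alpha)}{12s_l^2}+\frac13.$$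
   Context: For $\alpha\in\mathbb{C}\setminus\{-1,-2,\dots\}$ let $\mathcal{I}_\alpha$ be the entire function $$\mathcal{I}_\alpha(z)=2^\alpha\Gamma(\alpha+1)\frac{J_\alpha(iz)}{(iz)^\alpha}=\Gamma(\alpha+1)\sum_{n=0}^\infty\frac{(z/2)^{2n}}{n!\,\Gamma(n+\alpha+1)},$$ where $J_\alpha$ is the Bessel function of order $\alpha$; $\mathcal{I}_\alpha^{(m)}$ is its $m$-th derivative. The numbers $s_j=s_{j,\alpha}$, $j\in\mathbb{Z}\setminus\{0\}$, are the zeros (all nonzero and simple) of the even entire function $J_{\alpha+1}(x)/x^{\alpha+1}$, indexed so that $s_{-j}=-s_j$ and $0\le\operatorname{Re}s_j\le\operatorname{Re}s_{j+1}$ for $j\ge1$. Series over $\mathbb{Z}\setminus\{0\}$ or $\mathbb{Z}\setminus\{0,l\}$ are understood as principal values, i.e. as limits of the sums over the indices with $|j|\le N$ as $N\to\infty$. For $v\in\mathbb{C}$ which is neither $0$ nor a zero of $\mathcal{I}_{\alpha+1}$, the Calogero-Dunkl numbers $\mathfrak{a}_{n,\alpha,v}$, $n\ge0$, are defined by the expansion (for $t$ near $0$) $$\frac{\mathcal{I}_\alpha(t+v)}{(t+v)\,\mathcal{I}_{\alpha+1}(t+v)}=\sum_{n=0}^\infty\mathfrak{a}_{n,\alpha,v}\,t^n.$$ *)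

theory Defs
  imports "HOL-Complex_Analysis.Complex_Analysis"
begin

definition bessel_J :: "complex \<Rightarrow> complex \<Rightarrow> complex" where
  "bessel_J \<nu> x = (x / 2) powr \<nu> *
     (\<Sum>n. (-1) ^ n * (x / 2) ^ (2 * n) / (fact n * Gamma (of_nat n + \<nu> + 1)))"

(* The even entire function J_nu(x) / x^nu.  Since 0 powr nu = 0, the quotient has to be
   completed at x = 0 by its limit there; otherwise 0 would become a spurious zero. *)
definition bessel_J_quot :: "complex \<Rightarrow> complex \<Rightarrow> complex" where
  "bessel_J_quot \<nu> x =
     (if x = 0 then 1 / (2 powr \<nu> * Gamma (\<nu> + 1)) else bessel_J \<nu> x / x powr \<nu>)"

definition calI :: "complex \<Rightarrow> complex \<Rightarrow> complex" where
  "calI \<alpha> z = Gamma (\<alpha> + 1) *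
     (\<Sum>n. (z / 2) ^ (2 * n) / (fact n * Gamma (of_nat n + \<alpha> + 1)))"

lemma bessel_J_quot_eq:
  "bessel_J_quot \<nu> x = (1 / 2 powr \<nu>) *
     (\<Sum>n. (-1) ^ n * (x / 2) ^ (2 * n) / (fact n * Gamma (of_nat n + \<nu> + 1)))"
proof (cases "x = 0")
  case True
  have "(\<Sum>n. (-1) ^ n * (x / 2) ^ (2 * n) / (fact n * Gamma (of_nat n + \<nu> + 1)))
      = (\<Sum>n\<in>{0::nat}. (-1) ^ n * (x / 2) ^ (2 * n) / (fact n * Gamma (of_nat n + \<nu> + 1)))"
    by (rule suminf_finite) (use True in auto)
  then show ?thesis
    using True by (simp add: bessel_J_quot_def)
next
  case False
  have "Ln (x / 2) = Ln x - Ln 2"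
    using False Ln_divide_of_real[of 2 x] Ln_of_real[of 2] by simp
  then have "(x / 2) powr \<nu> = x powr \<nu> / 2 powr \<nu>"
    using False by (simp add: powr_def exp_diff right_diff_distrib)
  then show ?thesis
    using False by (simp add: bessel_J_quot_def bessel_J_def)
qed

lemma calI_eq_bessel_J_quot:
  "calI \<alpha> z = 2 powr \<alpha> * Gamma (\<alpha> + 1) * bessel_J_quot \<alpha> (\<i> * z)"
proof -
  have "(-1) ^ n * (\<i> * z / 2) ^ (2 * n) = (- ((\<i> * z / 2)\<^sup>2)) ^ n" for n
    by (simp only: power_mult power_minus[of "(\<i> * z / 2)\<^sup>2"])
  moreover have "- ((\<i> * z / 2)\<^sup>2) = (z / 2)\<^sup>2"
    by (simp add: power_mult_distrib power_divide)
  ultimately have "(-1) ^ n * (\<i> * z / 2) ^ (2 * n) = (z / 2) ^ (2 * n)" for n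
    by (simp only: power_mult)
  then show ?thesis
    by (simp add: calI_def bessel_J_quot_eq)
qed

lemma calI_eq_bessel_J:
  assumes "z \<noteq> 0"
  shows "calI \<alpha> z = 2 powr \<alpha> * Gamma (\<alpha> + 1) * (bessel_J \<alpha> (\<i> * z) / (\<i> * z) powr \<alpha>)"
  using assms by (simp add: calI_eq_bessel_J_quot bessel_J_quot_def)

(* The value s 0 is irrelevant.  Every zero is listed exactly once: for
   alpha not in {-1, -2, ...} all zeros are simple and nonzero. *)
definition bessel_zero_enum :: "complex \<Rightarrow> (int \<Rightarrow> complex) \<Rightarrow> bool" where
  "bessel_zero_enum \<alpha> s \<longleftrightarrow>
     bij_betw s (UNIV - {0}) {x. bessel_J_quot (\<alpha> + 1) x = 0} \<and>
     (\<forall>j\<ge>1. s (- j) = - s j \<and> 0 \<le> Re (s j) \<and> Re (s j) \<le> Re (s (j + 1)))"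

definition calogero_dunkl :: "nat \<Rightarrow> complex \<Rightarrow> complex \<Rightarrow> complex" where
  "calogero_dunkl n \<alpha> v =
     fps_nth (fps_expansion (\<lambda>t. calI \<alpha> (t + v) / ((t + v) * calI (\<alpha> + 1) (t + v))) 0) n"

definition pv_partial :: "int set \<Rightarrow> (int \<Rightarrow> complex) \<Rightarrow> nat \<Rightarrow> complex" where
  "pv_partial A f N = (\<Sum>j\<in>{j\<in>A. \<bar>j\<bar> \<le> int N}. f j)"

definition pv_summable :: "int set \<Rightarrow> (int \<Rightarrow> complex) \<Rightarrow> bool" where
  "pv_summable A f \<longleftrightarrow> convergent (pv_partial A f)"

definition pv_sum :: "int set \<Rightarrow> (int \<Rightarrow> complex) \<Rightarrow> complex" where
  "pv_sum A f = lim (pv_partial A f)"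

definition eta :: "(int \<Rightarrow> complex) \<Rightarrow> nat \<Rightarrow> complex \<Rightarrow> complex" where
  "eta s k u = pv_sum (UNIV - {0}) (\<lambda>j. 1 / (s j - u) ^ (k + 1))"

definition eta_omit :: "(int \<Rightarrow> complex) \<Rightarrow> nat \<Rightarrow> int \<Rightarrow> complex" where
  "eta_omit s k l = pv_sum (UNIV - {0, l}) (\<lambda>j. 1 / (s j - s l) ^ (k + 1))"

end

theory Submission
  imports Defs
begin

text \<open>
  The heart of the matter is the partial fraction expansion of the logarithmic derivative of
  \<open>calI (\<alpha> + 1)\<close>. In the variable \<open>w = z\<^sup>2 / 4\<close> the function \<open>calI \<alpha>\<close> becomes the confluent
  hypergeometric limit function, which is entire of order \<open>1 / 2\<close>; so the Hadamard product has genus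
  zero. Dividing out the zeros in a disc of radius \<open>R\<close> leaves a zero-free quotient whose logarithmic
  derivative at the centre is \<open>O(R powr (-1/2))\<close> by the maximum principle and the Schwarz lemma.
  Since \<open>calI (\<alpha> + 1)\<close> is, up to an elementary factor, the derivative of \<open>calI \<alpha>\<close>, the limit of the
  partial sums of \<open>1 / (s j - z)\<close> is \<open>2 (1 + \<alpha>) / z - \<i> I / I'\<close>, with \<open>I\<close> and \<open>I'\<close> the values of
  \<open>calI \<alpha>\<close> and its derivative at \<open>\<i> z\<close>. The partial sums converge locally uniformly, so their Taylor
  coefficients converge too; multiplying by \<open>I'\<close> and comparing coefficients at \<open>u\<close>, respectively at
  \<open>s l\<close> after removing the pole there, gives both recurrences. The two closed forms follow from the
  cases \<open>k = 1\<close> and \<open>k = 2\<close> by means of the modified Bessel equation.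
\<close>

subsection \<open>Entire functions of order one half\<close>

text \<open>
  The Borel-Caratheodory inequality at the centre of the disc: for \<open>p = ln h - ln (h 0)\<close> the
  condition \<open>Re p < A\<close> says that \<open>p / (2 * A - p)\<close> maps into the unit disc.
\<close>

lemma norm_deriv_le_of_log_norm_less:
  fixes h :: "complex \<Rightarrow> complex"
  assumes holo: "h holomorphic_on ball 0 R" and "R > 0" "A > 0"
    and nz: "\<And>z. z \<in> ball 0 R \<Longrightarrow> h z \<noteq> 0"
    and less: "\<And>z. z \<in> ball 0 R \<Longrightarrow> norm (h z) < exp A * norm (h 0)"
  shows "norm (deriv h 0) \<le> 2 * A / R * norm (h 0)"
proof -
  obtain g where g: "g holomorphic_on ball 0 R" "\<And>z. z \<in> ball 0 R \<Longrightarrow> h z = exp (g z)"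
    using contractible_imp_holomorphic_log[OF holo _ nz] convex_imp_contractible[OF convex_ball]
    by blast
  define p where "p = (\<lambda>z. g (of_real R * z) - g 0)"
  have in_ball: "of_real R * z \<in> ball 0 R" if "z \<in> ball 0 1" for z :: complex
    using that \<open>R > 0\<close> by (simp add: norm_mult)
  have Re_p: "Re (p z) < A" if "z \<in> ball 0 1" for z
  proof -
    have "exp (Re (p z)) * norm (h 0) = norm (h (of_real R * z))"
      using g(2)[OF in_ball[OF that]] g(2)[of 0] \<open>R > 0\<close>
      by (simp add: p_def exp_diff)
    also have "\<dots> < exp A * norm (h 0)"
      using less[OF in_ball[OF that]] .
    finally show ?thesis
      using nz[of 0] \<open>R > 0\<close> by simp
  qed
  define \<phi> where "\<phi> = (\<lambda>z. p z / (2 * of_real A - p z))"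
  have den: "2 * of_real A - p z \<noteq> 0" if "z \<in> ball 0 1" for z
  proof
    assume "2 * of_real A - p z = 0"
    then have "Re (2 * of_real A - p z) = 0" by simp
    then show False using Re_p[OF that] \<open>A > 0\<close> by simp
  qed
  have norm_phi: "norm (\<phi> z) < 1" if "norm z < 1" for z
  proof -
    have "norm (p z) < norm (2 * of_real A - p z)"
    proof -
      \<comment> \<open>The difference of the two squares is 4 * A * (A - Re (p z)), and the
        imaginary parts agree up to sign.\<close>
      have "(Re (p z))\<^sup>2 < (2 * A - Re (p z))\<^sup>2"
        using mult_pos_pos[of A "A - Re (p z)"] Re_p[of z] that \<open>A > 0\<close>
        by (simp add: power2_eq_square algebra_simps)
      then show ?thesis
        by (simp add: cmod_def)
    qed
    then show ?thesis
      using den[of z] that by (simp add: \<phi>_def norm_divide divide_simps)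
  qed
  have holp: "p holomorphic_on ball 0 1"
    unfolding p_def
    by (intro holomorphic_intros holomorphic_on_compose_gen[OF _ g(1), unfolded o_def])
       (use in_ball in auto)
  then have "\<phi> holomorphic_on ball 0 1"
    unfolding \<phi>_def by (intro holomorphic_intros) (use den in auto)
  moreover have "\<phi> 0 = 0" by (simp add: \<phi>_def p_def)
  ultimately have "norm (deriv \<phi> 0) \<le> 1"
    using Schwarz_Lemma(2)[of \<phi> 0] norm_phi by simp
  have dg: "(g has_field_derivative deriv g 0) (at 0)"
    using g(1) \<open>R > 0\<close> by (intro holomorphic_derivI[of g "ball 0 R"]) auto
  have dp: "(p has_field_derivative deriv g 0 * of_real R) (at 0)"
  proof -
    have "((\<lambda>z. of_real R * z) has_field_derivative (of_real R :: complex)) (at 0)"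
      by (auto intro!: derivative_eq_intros)
    then have "((\<lambda>z. g (of_real R * z)) has_field_derivative deriv g 0 * of_real R) (at 0)"
      using DERIV_chain2[of g "deriv g 0" "\<lambda>z. of_real R * z" 0 "of_real R" UNIV] dg by simp
    then show ?thesis
      unfolding p_def using DERIV_diff[OF _ DERIV_const] by fastforce
  qed
  have "(\<phi> has_field_derivative deriv g 0 * of_real R / (2 * of_real A)) (at 0)"
  proof -
    have p0: "p 0 = 0" by (simp add: p_def)
    have "2 * of_real A - p 0 \<noteq> 0" using den[of 0] by simp
    from DERIV_divide[OF dp DERIV_diff[OF DERIV_const dp] this]
    show ?thesis using \<open>A > 0\<close> by (simp add: \<phi>_def p0 mult.commute)
  qed
  then have "deriv \<phi> 0 = deriv g 0 * of_real R / (2 * of_real A)"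
    by (rule DERIV_imp_deriv)
  with \<open>norm (deriv \<phi> 0) \<le> 1\<close> have "norm (deriv g 0) * R \<le> 2 * A"
    using \<open>A > 0\<close> \<open>R > 0\<close> by (simp add: norm_mult norm_divide divide_simps)
  moreover have "deriv h 0 = deriv g 0 * h 0"
  proof -
    have "((\<lambda>z. exp (g z)) has_field_derivative exp (g 0) * deriv g 0) (at 0)"
      by (auto intro!: derivative_eq_intros dg)
    then have "(h has_field_derivative exp (g 0) * deriv g 0) (at 0)"
      by (rule has_field_derivative_transform_within_open[of _ _ _ "ball 0 R"])
         (use g(2) \<open>R > 0\<close> in auto)
    then show ?thesis using g(2)[of 0] \<open>R > 0\<close>
      by (simp add: DERIV_imp_deriv mult.commute)
  qed
  ultimately have "norm (deriv h 0) * R \<le> 2 * A * norm (h 0)"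
    using mult_right_mono[of "norm (deriv g 0) * R" "2 * A" "norm (h 0)"]
    by (simp add: norm_mult mult_ac)
  then show ?thesis
    using \<open>R > 0\<close> by (simp add: field_simps)
qed

text \<open>The factors 1 - z / w equal 1 at the origin, so \<open>h\<close> keeps the value of
  \<open>f\<close> there, and the derivative at 0 splits into the contribution of the zeros and
  \<open>deriv h 0\<close>. This remainder is what later has to tend to 0.\<close>

lemma entire_divide_out_zeros:
  fixes f :: "complex \<Rightarrow> complex"
  assumes "f holomorphic_on UNIV" "finite S" "\<And>w. w \<in> S \<Longrightarrow> f w = 0 \<and> w \<noteq> 0"
  shows "\<exists>h. h holomorphic_on UNIV \<and> (\<forall>z. f z = (\<Prod>w\<in>S. 1 - z / w) * h z) \<and>
           h 0 = f 0 \<and> deriv f 0 = (\<Sum>w\<in>S. - 1 / w) * f 0 + deriv h 0"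
  using assms(2,3)
proof (induction S rule: finite_induct)
  case empty
  then show ?case using assms(1) by (intro exI[of _ f]) auto
next
  case (insert w S)
  then obtain h where h: "h holomorphic_on UNIV" "\<And>z. f z = (\<Prod>w\<in>S. 1 - z / w) * h z"
    "h 0 = f 0" "deriv f 0 = (\<Sum>w\<in>S. - 1 / w) * f 0 + deriv h 0"
    by (metis insertCI)
  have "w \<noteq> 0" "f w = 0" using insert.prems by auto
  have "(\<Prod>w'\<in>S. 1 - w / w') \<noteq> 0"
    using insert by (auto simp: prod_zero_iff field_simps)
  with h(2)[of w] \<open>f w = 0\<close> have hw: "h w = 0" by simp
  \<comment> \<open>The removable singularity of h z / (1 - z / w) at \<open>w\<close> is filled
    with the derivative; the factor - w turns 1 / (z - w) into 1 / (1 - z / w).\<close>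
  define q where "q = (\<lambda>z. - w * (if z = w then deriv h w else (h z - h w) / (z - w)))"
  have q: "q holomorphic_on UNIV"
    unfolding q_def by (intro holomorphic_intros pole_lemma_open h) auto
  have hq: "h z = (1 - z / w) * q z" for z
    using hw \<open>w \<noteq> 0\<close> by (auto simp: q_def field_simps)
  have "((\<lambda>z. (1 - z / w) * q z) has_field_derivative - 1 / w * q 0 + deriv q 0) (at 0)"
    using holomorphic_derivI[OF q, of 0] \<open>w \<noteq> 0\<close>
    by (auto intro!: derivative_eq_intros)
  then have "deriv h 0 = - 1 / w * q 0 + deriv q 0"
    by (simp add: DERIV_imp_deriv flip: hq)
  moreover have "q 0 = f 0" using hq[of 0] h(3) by simp
  ultimately have "deriv f 0 = (\<Sum>w\<in>insert w S. - 1 / w) * f 0 + deriv q 0"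
    unfolding h(4) using insert.hyps by (simp add: algebra_simps)
  moreover have "f z = (\<Prod>w\<in>insert w S. 1 - z / w) * q z" for z
    unfolding h(2)[of z] hq[of z] using insert.hyps by simp
  ultimately show ?case
    using q \<open>q 0 = f 0\<close> by blast
qed

section \<open>Zeros and logarithmic derivative under growth of order one half\<close>

text \<open>Order at most 1 / 2 forces genus zero. Simplicity lets the zero set stand for the zeros
  with multiplicity, and \<open>f 0 \<noteq> 0\<close> allows the normalised factors 1 - z /
  w.\<close>

locale genus_zero =
  fixes f :: "complex \<Rightarrow> complex" and K C :: real
  assumes holo: "f holomorphic_on UNIV"
    and simple: "\<And>w. f w = 0 \<Longrightarrow> deriv f w \<noteq> 0"
    and nz: "f 0 \<noteq> 0"
    and C: "C \<ge> 0"
    and growth: "\<And>z. norm (f z) \<le> K * exp (C * sqrt (norm z))"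
begin

lemma f0_le: "norm (f 0) \<le> K"
  using growth[of 0] by simp

lemma K_pos: "K > 0"
  using f0_le nz by (smt (verit) zero_less_norm_iff)

definition L where "L = ln (K / norm (f 0))"

lemma L_nonneg: "L \<ge> 0"
  unfolding L_def using f0_le nz by (intro ln_ge_zero) auto

lemma K_times_exp: "K * exp x = exp (L + x) * norm (f 0)"
  unfolding L_def using K_pos nz by (simp add: exp_add)

text \<open>On the circle of radius (q + 1) * R each factor 1 - z / w has modulus at least q,
  because norm (z / w) is at least q + 1; the maximum principle carries the bound inside. It serves
  with q = 3 to count zeros and with q = 1 to bound the zero-free quotient.\<close>

lemma quotient_bound:
  assumes S: "finite S" "\<And>w. w \<in> S \<Longrightarrow> f w = 0 \<and> norm w \<le> R"
    and h: "h holomorphic_on UNIV" "\<And>z. f z = (\<Prod>w\<in>S. 1 - z / w) * h z"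
    and "R > 0" "q \<ge> 1" and z: "norm z \<le> (q + 1) * R"
  shows "q ^ card S * norm (h z) \<le> K * exp (C * sqrt ((q + 1) * R))"
proof -
  define T where "T = (q + 1) * R"
  have "T > 0" using \<open>R > 0\<close> \<open>q \<ge> 1\<close> by (simp add: T_def)
  have "norm (h z) \<le> K * exp (C * sqrt T) / q ^ card S"
  proof (rule maximum_modulus_frontier[where S = "cball 0 T" and f = h])
    show "h holomorphic_on interior (cball 0 T)"
      by (rule holomorphic_on_subset[OF h(1)]) auto
    show "continuous_on (closure (cball 0 T)) h"
      using holomorphic_on_imp_continuous_on[OF h(1)] continuous_on_subset by blast
    show "bounded (cball 0 T)" by simp
    show "z \<in> cball 0 T" using z by (simp add: T_def)
    fix z :: complex assume "z \<in> frontier (cball 0 T)"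
    then have z: "norm z = T" using \<open>T > 0\<close> by (simp add: frontier_cball)
    have "q ^ card S = (\<Prod>w\<in>S. q)" by simp
    also have "\<dots> \<le> (\<Prod>w\<in>S. norm (1 - z / w))"
    proof (intro prod_mono conjI)
      fix w assume "w \<in> S"
      then have w: "norm w \<le> R" "norm w > 0" using S nz by auto
      have "q + 1 \<le> norm z / norm w"
        using w z \<open>q \<ge> 1\<close> by (simp add: T_def divide_simps)
      also have "\<dots> \<le> norm (1 - z / w) + 1"
        using norm_triangle_ineq4[of 1 "1 - z / w"] by (simp add: norm_divide)
      finally show "q \<le> norm (1 - z / w)" by simp
    qed (use \<open>q \<ge> 1\<close> in auto)
    finally have "q ^ card S * norm (h z) \<le> norm (f z)"
      unfolding h(2)[of z] norm_mult prod_norm[symmetric] by (intro mult_right_mono) auto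
    also have "\<dots> \<le> K * exp (C * sqrt T)" using growth[of z] z by simp
    finally show "norm (h z) \<le> K * exp (C * sqrt T) / q ^ card S"
      using \<open>q \<ge> 1\<close> by (simp add: field_simps)
  qed
  then show ?thesis using \<open>q \<ge> 1\<close> by (simp add: T_def field_simps)
qed

text \<open>A Jensen-type count: at the centre the quotient equals \<open>f 0\<close>, and q = 3
  exceeds e, so the cardinality appears as an exponent and is read off by logarithms.\<close>

lemma card_zeros_le:
  assumes S: "finite S" "\<And>w. w \<in> S \<Longrightarrow> f w = 0 \<and> norm w \<le> R" and "R > 0"
  shows "real (card S) \<le> L + 2 * C * sqrt R"
proof -
  have "\<And>w. w \<in> S \<Longrightarrow> f w = 0 \<and> w \<noteq> 0" using S nz by auto
  then obtain h where h: "h holomorphic_on UNIV" "\<And>z. f z = (\<Prod>w\<in>S. 1 - z / w) * h z" "h 0 = f 0"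
    using entire_divide_out_zeros[OF holo S(1)] by blast
  have "sqrt (4 * R) = 2 * sqrt R" by (simp add: real_sqrt_mult)
  then have *: "3 ^ card S * norm (f 0) \<le> K * exp (2 * C * sqrt R)"
    using quotient_bound[OF S h(1,2) \<open>R > 0\<close>, of 3 0] h(3) \<open>R > 0\<close> by (simp add: mult_ac)
  have "exp (real (card S)) = exp 1 ^ card S" by (simp flip: exp_of_nat_mult)
  also have "\<dots> \<le> 3 ^ card S" by (intro power_mono exp_le) auto
  also have "\<dots> \<le> exp (L + 2 * C * sqrt R)"
    using * nz by (simp add: K_times_exp)
  finally show ?thesis by simp
qed

lemma finite_zeros_cball: "finite {w. f w = 0 \<and> norm w \<le> R}"
proof (cases "R > 0")
  case True
  show ?thesis
  proof (rule conjunct1, rule finite_if_finite_subsets_card_bdd)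
    fix G assume "G \<subseteq> {w. f w = 0 \<and> norm w \<le> R}" "finite G"
    then show "card G \<le> nat \<lfloor>L + 2 * C * sqrt R\<rfloor>"
      using card_zeros_le[of G R, THEN le_nat_floor] True by blast
  qed
next
  case False
  then have "{w. f w = 0 \<and> norm w \<le> R} \<subseteq> {0}"
    using norm_ge_zero norm_eq_zero by (smt (verit) mem_Collect_eq singletonI subsetI)
  then show ?thesis by (rule finite_subset) simp
qed

text \<open>Zeros are added in order of increasing modulus. When \<open>x\<close> is added, all
  zeros so far lie in the disc of radius norm x, so the counting bound applies there and the sum is
  compared with that of 1 / n^2.\<close>

lemma summable_inverse_zeros: "(\<lambda>w. 1 / norm w) summable_on {w. f w = 0}"
proof -
  have "continuous_on UNIV f" using holo by (rule holomorphic_on_imp_continuous_on)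
  then have "continuous (at 0) f" by (simp add: continuous_on_eq_continuous_at)
  then obtain r where r: "r > 0" "\<And>z. dist 0 z < r \<Longrightarrow> f z \<noteq> 0"
    using continuous_at_avoid[of 0 f 0] nz by blast
  then have r_le: "r \<le> norm w" if "f w = 0" for w
    using that by (metis dist_0_norm not_le)
  \<comment> \<open>No zero has modulus below \<open>r\<close>, so \<open>L\<close> is at most L /
    sqrt r times sqrt (norm w); \<open>D\<close> absorbs both terms of the count.\<close>
  define D where "D = L / sqrt r + 2 * C"
  \<comment> \<open>The zero counting bound says that the \<open>n\<close>-th smallest zero has modulus at least \<open>n\<^sup>2 / D\<^sup>2\<close>.\<close>
  have bound: "(\<Sum>w\<in>S. 1 / norm w) \<le> D\<^sup>2 * (\<Sum>k<card S. 1 / real (Suc k) ^ 2)"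
    if "finite S" "S \<subseteq> {w. f w = 0}" for S
    using that
  proof (induction S rule: finite_ranking_induct[where f = norm])
    case (insert x S)
    show ?case
    proof (cases "x \<in> S")
      case False
      have x: "f x = 0" "r \<le> norm x" "norm x > 0" using insert r_le r(1) by force+
      have "real (card (insert x S)) \<le> L + 2 * C * sqrt (norm x)"
        using insert x by (intro card_zeros_le) auto
      also have "L \<le> L * (sqrt (norm x) / sqrt r)"
        using mult_left_mono[OF _ L_nonneg, of 1 "sqrt (norm x) / sqrt r"] x r by simp
      finally have "real (Suc (card S)) \<le> D * sqrt (norm x)"
        using insert False by (simp add: D_def algebra_simps)
      then have "real (Suc (card S)) ^ 2 \<le> (D * sqrt (norm x)) ^ 2"
        by (intro power_mono) auto
      then have "real (Suc (card S)) ^ 2 \<le> D\<^sup>2 * norm x"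
        by (simp add: power_mult_distrib)
      then have "1 / norm x \<le> D\<^sup>2 * (1 / real (Suc (card S)) ^ 2)"
        using x by (simp add: divide_simps mult_ac)
      then show ?thesis
        using insert False by (simp add: algebra_simps)
    qed (use insert in \<open>simp add: insert_absorb\<close>)
  qed simp
  have sm: "summable (\<lambda>k. 1 / real (Suc k) ^ 2)"
    using inverse_power_summable[of 2, where ?'a = real]
    by (subst summable_Suc_iff) (simp add: field_simps)
  have "(\<Sum>w\<in>S. 1 / norm w) \<le> D\<^sup>2 * (\<Sum>k. 1 / real (Suc k) ^ 2)"
    if "finite S" "S \<subseteq> {w. f w = 0}" for S
    using bound[OF that]
      mult_left_mono[OF sum_le_suminf[OF sm, of "{..<card S}"], of "D\<^sup>2"] by fastforce
  then have "bdd_above (sum (\<lambda>w. 1 / norm w) ` {F. F \<subseteq> {w. f w = 0} \<and> finite F})"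
    by (intro bdd_aboveI) auto
  then show ?thesis
    by (intro nonneg_bdd_above_summable_on) auto
qed

text \<open>Dividing out the zeros of modulus at most n leaves a quotient without zeros in the open
  disc of radius n, whose logarithmic derivative at 0 is O(1 / sqrt n). This gives the limit along
  discs; absolute summability makes it the unconditional sum.\<close>

lemma has_sum_inverse_zeros: "((\<lambda>w. - 1 / w) has_sum deriv f 0 / f 0) {w. f w = 0}"
proof -
  define Z where "Z = (\<lambda>n. {w. f w = 0 \<and> norm w \<le> real n})"
  have close: "norm ((\<Sum>w\<in>Z n. - 1 / w) - deriv f 0 / f 0)
      \<le> 2 * (L + C * sqrt (2 * real n) + 1) / real n" if "n > 0" for n
  proof -
    \<comment> \<open>Here 2 * n is the radius (q + 1) * R for q = 1 and R = n; the extra 1 makes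
      the bound on norm (h z) strict.\<close>
    let ?A = "L + C * sqrt (2 * real n) + 1"
    have A: "?A > 0" using L_nonneg C by (simp add: add_nonneg_pos)
    have Z: "finite (Z n)" "\<And>w. w \<in> Z n \<Longrightarrow> f w = 0 \<and> w \<noteq> 0"
      "\<And>w. w \<in> Z n \<Longrightarrow> f w = 0 \<and> norm w \<le> real n"
      using finite_zeros_cball nz by (auto simp: Z_def)
    from entire_divide_out_zeros[OF holo Z(1,2)] obtain h where
      h: "h holomorphic_on UNIV" "\<And>z. f z = (\<Prod>w\<in>Z n. 1 - z / w) * h z" "h 0 = f 0"
         "deriv f 0 = (\<Sum>w\<in>Z n. - 1 / w) * f 0 + deriv h 0" by blast
    \<comment> \<open>A zero of \<open>h\<close> in the disc would be a zero of \<open>f\<close>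
      already divided out, hence also a zero of the product, so \<open>f\<close> would have a double
      zero.\<close>
    have h_nz: "h z \<noteq> 0" if z: "z \<in> ball 0 (real n)" for z
    proof
      assume hz: "h z = 0"
      then have "f z = 0" using h(2) by simp
      with z have "z \<in> Z n" by (auto simp: Z_def)
      have "(\<lambda>z. \<Prod>w\<in>Z n. 1 - z / w) holomorphic_on UNIV"
        using Z(2) by (intro holomorphic_intros) auto
      from holomorphic_derivI[OF this, of z] holomorphic_derivI[OF h(1), of z]
      have "((\<lambda>z. (\<Prod>w\<in>Z n. 1 - z / w) * h z) has_field_derivative
          (\<Prod>w\<in>Z n. 1 - z / w) * deriv h z) (at z)"
        using hz by (auto intro!: derivative_eq_intros)
      moreover have "(\<Prod>w\<in>Z n. 1 - z / w) = 0"
        using \<open>z \<in> Z n\<close> Z by (intro prod_zero) (auto intro!: bexI[of _ z])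
      ultimately have "deriv f z = 0"
        by (simp add: DERIV_imp_deriv flip: h(2))
      with simple \<open>f z = 0\<close> show False by blast
    qed
    have "norm (deriv h 0) \<le> 2 * ?A / real n * norm (h 0)"
    proof (rule norm_deriv_le_of_log_norm_less[OF _ _ A h_nz])
      show "h holomorphic_on ball 0 (real n)" using h(1) holomorphic_on_subset by blast
      fix z :: complex assume "z \<in> ball 0 (real n)"
      then have "norm (h z) \<le> K * exp (C * sqrt (2 * real n))"
        using quotient_bound[OF Z(1,3) h(1,2), of 1 z] \<open>n > 0\<close> by simp
      also have "\<dots> < exp ?A * norm (h 0)"
        using h(3) nz by (simp add: K_times_exp)
      finally show "norm (h z) < exp ?A * norm (h 0)" .
    qed (use \<open>n > 0\<close> in auto)
    moreover have "(\<Sum>w\<in>Z n. - 1 / w) - deriv f 0 / f 0 = - (deriv h 0 / f 0)"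
      using h(4) nz by (simp add: field_simps)
    ultimately show ?thesis
      using nz h(3) \<open>n > 0\<close> by (simp add: norm_divide divide_simps)
  qed
  have "(\<lambda>n. 2 * (L + C * sqrt (2 * real n) + 1) / real n) \<longlonglongrightarrow> 0"
  proof -
    have "(\<lambda>n. 1 / real n) \<longlonglongrightarrow> 0" "(\<lambda>n. sqrt (2 * real n) / real n) \<longlonglongrightarrow> 0"
      by real_asymp+
    then have "(\<lambda>n. 2 * (L + 1) * (1 / real n) + 2 * C * (sqrt (2 * real n) / real n))
        \<longlonglongrightarrow> 2 * (L + 1) * 0 + 2 * C * 0"
      by (intro tendsto_intros)
    then show ?thesis by (simp add: add_divide_distrib algebra_simps)
  qed
  moreover have "\<forall>\<^sub>F n in sequentially. norm ((\<Sum>w\<in>Z n. - 1 / w) - deriv f 0 / f 0)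
      \<le> 2 * (L + C * sqrt (2 * real n) + 1) / real n"
    using eventually_gt_at_top[of "0::nat"] by (rule eventually_mono) (rule close)
  ultimately have "(\<lambda>n. (\<Sum>w\<in>Z n. - 1 / w) - deriv f 0 / f 0) \<longlonglongrightarrow> 0"
    by (rule Lim_null_comparison[rotated])
  then have lim: "(\<lambda>n. \<Sum>w\<in>Z n. - 1 / w) \<longlonglongrightarrow> deriv f 0 / f 0"
    by (rule LIM_zero_cancel)
  have "(\<lambda>w. norm (- 1 / w)) summable_on {w. f w = 0}"
    using summable_inverse_zeros by (simp add: norm_divide)
  then have "(\<lambda>w. - 1 / w) summable_on {w. f w = 0}"
    by (rule abs_summable_summable)
  then obtain S where S: "((\<lambda>w. - 1 / w) has_sum S) {w. f w = 0}"
    by (auto simp: summable_on_def)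
  \<comment> \<open>The discs exhaust the zero set, so the sums over them are cofinal among the
    finite partial sums.\<close>
  have "filterlim Z (finite_subsets_at_top {w. f w = 0}) sequentially"
    unfolding filterlim_def le_filter_def eventually_filtermap eventually_finite_subsets_at_top
  proof clarify
    fix P X assume X: "finite X" "X \<subseteq> {w. f w = 0}"
      and P: "\<forall>Y. finite Y \<and> X \<subseteq> Y \<and> Y \<subseteq> {w. f w = 0} \<longrightarrow> P Y"
    have "bdd_above (norm ` X)" using X(1) by simp
    then obtain B where "\<And>w. w \<in> X \<Longrightarrow> norm w \<le> B" by (auto simp: bdd_above_def)
    then obtain N where N: "\<And>w. w \<in> X \<Longrightarrow> norm w \<le> real N"
      by (meson order_trans real_arch_simple)
    show "\<forall>\<^sub>F n in sequentially. P (Z n)"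
    proof (rule eventually_mono[OF eventually_ge_at_top[of N]])
      fix n assume "N \<le> n"
      then have "norm w \<le> real n" if "w \<in> X" for w
        using N[OF that] by linarith
      then show "P (Z n)"
        using P X finite_zeros_cball[of "real n"] unfolding Z_def by blast
    qed
  qed
  with S have "(\<lambda>n. \<Sum>w\<in>Z n. - 1 / w) \<longlonglongrightarrow> S"
    unfolding has_sum_def by (rule filterlim_compose)
  with lim have "S = deriv f 0 / f 0" by (intro LIMSEQ_unique)
  with S show ?thesis by simp
qed

text \<open>Translation by \<open>u\<close> preserves the hypotheses: by subadditivity of the square
  root only the constant \<open>K\<close> grows, by exp (C * sqrt (norm u)). The result at the
  centre then applies to the shifted function.\<close>

lemma has_sum_log_deriv:
  assumes "f u \<noteq> 0"
  shows "((\<lambda>w. 1 / (u - w)) has_sum deriv f u / f u) {w. f w = 0}"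
proof -
  have deriv: "deriv (\<lambda>z. f (z + u)) w = deriv f (w + u)" for w
    using holomorphic_derivI[OF holo, of "w + u" UNIV]
    by (intro DERIV_imp_deriv) (simp only: DERIV_shift open_UNIV UNIV_I)
  interpret shift: genus_zero "\<lambda>z. f (z + u)" "K * exp (C * sqrt (norm u))" C
  proof
    show "(\<lambda>z. f (z + u)) holomorphic_on UNIV"
      by (rule holomorphic_on_compose_gen[OF _ holo, unfolded o_def]) (auto intro!: holomorphic_intros)
    fix z
    have "sqrt (norm (z + u)) \<le> sqrt (norm z + norm u)"
      by (simp add: norm_triangle_ineq)
    also have "\<dots> \<le> sqrt (norm z) + sqrt (norm u)"
      by (simp add: sqrt_add_le_add_sqrt)
    finally have "C * sqrt (norm (z + u)) \<le> C * sqrt (norm u) + C * sqrt (norm z)"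
      using mult_left_mono[OF _ C] by (fastforce simp: algebra_simps)
    then have "K * exp (C * sqrt (norm (z + u))) \<le> K * exp (C * sqrt (norm u) + C * sqrt (norm z))"
      using K_pos by simp
    then show "norm (f (z + u)) \<le> K * exp (C * sqrt (norm u)) * exp (C * sqrt (norm z))"
      using growth[of "z + u"] by (simp add: exp_add)
  qed (use simple assms C deriv in auto)
  have "((\<lambda>w. 1 / (u - w)) has_sum deriv f u / f u) {w. f w = 0} \<longleftrightarrow>
    ((\<lambda>w. - 1 / w) has_sum deriv (\<lambda>z. f (z + u)) 0 / f (0 + u)) {w. f (w + u) = 0}"
  proof (rule has_sum_reindex_bij_witness[of _ "\<lambda>w. w + u" "\<lambda>w. w - u"])
    show "- 1 / (a - u) = 1 / (u - a)" for a
      by (metis minus_diff_eq minus_divide_divide minus_minus)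
  qed (simp_all add: deriv)
  with shift.has_sum_inverse_zeros show ?thesis by blast
qed

end

subsection \<open>The confluent hypergeometric limit function\<close>

text \<open>The series 0F1(; b; w). Passing to w = z^2 / 4 halves the order of growth of the Bessel
  series.\<close>

definition hyp01 :: "complex \<Rightarrow> complex \<Rightarrow> complex" where
  "hyp01 b w = (\<Sum>n. 1 / (fact n * pochhammer b n) * w ^ n)"

text \<open>The distance of \<open>b\<close> from the nonpositive integers is positive, so every
  factor b + m has modulus at least a fixed multiple of m + 1.\<close>

lemma norm_pochhammer_ge:
  fixes b :: complex
  assumes "b \<notin> \<int>\<^sub>\<le>\<^sub>0"
  shows "\<exists>c>0. \<forall>n. c ^ n * fact n \<le> norm (pochhammer b n)"
proof -
  have "open (- \<int>\<^sub>\<le>\<^sub>0 :: complex set)" by (simp add: closed_nonpos_Ints flip: closed_def)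
  then obtain d where d: "d > 0" "ball b d \<subseteq> - \<int>\<^sub>\<le>\<^sub>0"
    using assms open_contains_ball by blast
  have ge_d: "d \<le> norm (b + of_nat m)" for m
  proof (rule ccontr)
    assume "\<not> d \<le> norm (b + of_nat m)"
    then have "- of_nat m \<in> ball b d" by (simp add: dist_norm)
    with d(2) show False by auto
  qed
  \<comment> \<open>Chosen to invert m + 1 \<le> norm (b + m) + norm (1 - b) \<le> (1 + norm (1 - b)
    / d) * norm (b + m).\<close>
  define c where "c = 1 / (1 + norm (1 - b) / d)"
  have den: "1 + norm (1 - b) / d > 0" using d(1) by (simp add: add_pos_nonneg)
  then have "c > 0" by (simp add: c_def)
  have step: "c * (real m + 1) \<le> norm (b + of_nat m)" for m
  proof -
    have "real m + 1 = norm (b + of_nat m + (1 - b))"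
      using norm_of_nat[of "Suc m", where ?'a = complex] by (simp add: add.commute)
    also have "\<dots> \<le> norm (b + of_nat m) + norm (1 - b)" by (rule norm_triangle_ineq)
    also have "norm (1 - b) \<le> norm (1 - b) / d * norm (b + of_nat m)"
      using mult_left_mono[OF ge_d, of "norm (1 - b)" m] d(1) by (simp add: field_simps)
    finally have "real m + 1 \<le> (1 + norm (1 - b) / d) * norm (b + of_nat m)"
      by (simp add: algebra_simps)
    then show ?thesis
      using den by (simp add: c_def divide_le_eq mult.commute)
  qed
  have "c ^ n * fact n \<le> norm (pochhammer b n)" for n
  proof (induction n)
    case (Suc n)
    then have "(c ^ n * fact n) * (c * (real n + 1)) \<le> norm (pochhammer b n) * norm (b + of_nat n)"
      using \<open>c > 0\<close> by (intro mult_mono step) auto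
    moreover have "c ^ Suc n * fact (Suc n) = (c ^ n * fact n) * (c * (real n + 1))" by simp
    ultimately show ?case by (simp only: pochhammer_Suc norm_mult)
  qed simp
  with \<open>c > 0\<close> show ?thesis by blast
qed

text \<open>With x = sqrt (norm w / c) each term is at most (x^n / n!)^2. Bounding one factor by exp
  x and summing the other gives exp (2 * x), hence the square root in the exponent.\<close>

lemma summable_hyp01_and_growth:
  assumes "b \<notin> \<int>\<^sub>\<le>\<^sub>0"
  shows "\<exists>C\<ge>0. \<forall>w. summable (\<lambda>n. 1 / (fact n * pochhammer b n) * w ^ n) \<and>
           norm (hyp01 b w) \<le> exp (C * sqrt (norm w))"
proof -
  obtain c where c: "c > 0" "\<And>n. c ^ n * fact n \<le> norm (pochhammer b n)"
    using norm_pochhammer_ge[OF assms] by blast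
  have "summable (\<lambda>n. 1 / (fact n * pochhammer b n) * w ^ n) \<and>
           norm (hyp01 b w) \<le> exp (2 / sqrt c * sqrt (norm w))" for w
  proof -
    define x where "x = sqrt (norm w / c)"
    have "x \<ge> 0" and x2: "x ^ 2 = norm w / c" using c(1) by (simp_all add: x_def)
    have sums: "(\<lambda>n. exp x * (x ^ n /\<^sub>R fact n)) sums (exp x * exp x)"
      by (intro sums_mult exp_converges)
    have le: "norm (1 / (fact n * pochhammer b n) * w ^ n) \<le> exp x * (x ^ n /\<^sub>R fact n)" for n
    proof -
      have "norm (1 / (fact n * pochhammer b n) * w ^ n)
          \<le> norm w ^ n / (fact n * (c ^ n * fact n))"
        using c(2)[of n] c(1)
        by (auto simp: norm_mult norm_divide norm_power norm_fact
            intro!: divide_left_mono mult_left_mono mult_pos_pos less_le_trans[OF _ c(2)[of n]])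
      also have "\<dots> = (x ^ n / fact n) * (x ^ n / fact n)"
        using x2 by (simp add: power_divide power_mult_distrib[symmetric] power2_eq_square
            flip: power_mult)
      also have "\<dots> \<le> exp x * (x ^ n / fact n)"
      proof (rule mult_right_mono)
        have "(\<Sum>k\<in>{n}. x ^ k /\<^sub>R fact k) \<le> (\<Sum>k. x ^ k /\<^sub>R fact k)"
          using \<open>x \<ge> 0\<close> by (intro sum_le_suminf summable_exp_generic) auto
        then show "x ^ n / fact n \<le> exp x" by (simp add: exp_def field_simps)
      qed (use \<open>x \<ge> 0\<close> in simp)
      finally show ?thesis by (simp add: divide_inverse mult_ac)
    qed
    have "summable (\<lambda>n. 1 / (fact n * pochhammer b n) * w ^ n)"
      by (rule summable_comparison_test'[OF sums_summable[OF sums] le])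
    moreover have "norm (hyp01 b w) \<le> exp x * exp x"
      unfolding hyp01_def
      using suminf_le[OF le _ sums_summable[OF sums]] sums_unique[OF sums]
        summable_norm[of "\<lambda>n. 1 / (fact n * pochhammer b n) * w ^ n"]
        summable_comparison_test'[OF sums_summable[OF sums], of 0 "\<lambda>n. norm (1 / (fact n * pochhammer b n) * w ^ n)"] le
      by fastforce
    moreover have "exp x * exp x = exp (2 / sqrt c * sqrt (norm w))"
      by (simp add: x_def real_sqrt_divide flip: exp_add)
    ultimately show ?thesis by simp
  qed
  then show ?thesis using c(1) by (intro exI[of _ "2 / sqrt c"]) auto
qed

lemma summable_hyp01:
  fixes b w :: complex
  assumes "b \<notin> \<int>\<^sub>\<le>\<^sub>0"
  shows "summable (\<lambda>n. 1 / (fact n * pochhammer b n) * w ^ n)"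
  using summable_hyp01_and_growth[OF assms] by blast

lemma hyp01_0 [simp]: "hyp01 b 0 = 1"
proof -
  have "hyp01 b 0 = (\<Sum>n\<in>{0}. 1 / (fact n * pochhammer b n) * 0 ^ n)"
    unfolding hyp01_def by (rule suminf_finite) auto
  then show ?thesis by simp
qed

lemma plus_of_nat_notin_nonpos_Ints:
  fixes b :: complex
  assumes "b \<notin> \<int>\<^sub>\<le>\<^sub>0" shows "b + of_nat n \<notin> \<int>\<^sub>\<le>\<^sub>0"
proof -
  have "b \<in> \<int>\<^sub>\<le>\<^sub>0" if "b + of_nat n \<in> \<int>\<^sub>\<le>\<^sub>0"
  proof -
    from that obtain m where "b + of_nat n = - of_nat m" by (elim nonpos_Ints_cases')
    then have "b = - of_nat (m + n)" by (simp add: algebra_simps)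
    then show ?thesis by (simp only: minus_of_nat_in_nonpos_Ints)
  qed
  with assms show ?thesis by blast
qed

lemma plus_1_notin_nonpos_Ints:
  fixes b :: complex
  assumes "b \<notin> \<int>\<^sub>\<le>\<^sub>0" shows "b + 1 \<notin> \<int>\<^sub>\<le>\<^sub>0"
  using plus_of_nat_notin_nonpos_Ints[OF assms, of 1] by simp

lemma DERIV_hyp01:
  assumes "b \<notin> \<int>\<^sub>\<le>\<^sub>0"
  shows "(hyp01 b has_field_derivative hyp01 (b + 1) w / b) (at w)"
proof -
  have "b \<noteq> 0" using assms by auto
  have "diffs (\<lambda>n. 1 / (fact n * pochhammer b n)) n
      = 1 / b * (1 / (fact n * pochhammer (b + 1) n))" for n
  proof -
    have "1 + of_nat n \<noteq> (0 :: complex)"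
      by (metis of_nat_Suc of_nat_eq_0_iff nat.distinct(1))
    then show ?thesis by (simp add: diffs_def pochhammer_rec)
  qed
  then have "(\<Sum>n. diffs (\<lambda>n. 1 / (fact n * pochhammer b n)) n * w ^ n) = hyp01 (b + 1) w / b"
    using suminf_mult[OF summable_hyp01[OF plus_1_notin_nonpos_Ints[OF assms]], of "1 / b" w]
    by (simp add: hyp01_def mult.assoc)
  then show ?thesis
    using termdiffs_strong_converges_everywhere[OF summable_hyp01[OF assms], of w]
    by (simp add: hyp01_def[abs_def])
qed

lemma hyp01_contiguous:
  assumes "b \<notin> \<int>\<^sub>\<le>\<^sub>0"
  shows "hyp01 b w = hyp01 (b + 1) w + w / (b * (b + 1)) * hyp01 (b + 2) w"
proof -
  have b1: "b + 1 \<notin> \<int>\<^sub>\<le>\<^sub>0" and b2: "b + 2 \<notin> \<int>\<^sub>\<le>\<^sub>0"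
    using plus_of_nat_notin_nonpos_Ints[OF assms, of 1]
      plus_of_nat_notin_nonpos_Ints[OF assms, of 2] by simp_all
  let ?a = "\<lambda>b n. 1 / (fact n * pochhammer b n) :: complex"
  have nz: "b + of_nat n \<noteq> 0" for n
    using plus_of_nat_notin_nonpos_Ints[OF assms, of n] by auto
  have "b \<noteq> 0" "b + 1 \<noteq> 0" using nz[of 0] nz[of 1] by simp_all
  have nz1: "b + 1 + of_nat n \<noteq> 0" for n using nz[of "Suc n"] by (simp add: add_ac)
  have coeff: "?a b (Suc n) - ?a (b + 1) (Suc n) = 1 / (b * (b + 1)) * ?a (b + 2) n" for n
  proof -
    define p where "p = pochhammer (b + 1) n"
    have "p \<noteq> 0" using b1 by (auto simp: p_def pochhammer_eq_0_iff)
    have "(b + 1) * pochhammer (b + 2) n = p * (b + 1 + of_nat n)"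
      using pochhammer_rec[of "b + 1" n] pochhammer_Suc[of "b + 1" n] by (simp add: p_def add_ac)
    then have p2: "pochhammer (b + 2) n = p * (b + 1 + of_nat n) / (b + 1)"
      using \<open>b + 1 \<noteq> 0\<close> by (simp add: field_simps)
    have 1: "?a b (Suc n) = 1 / ((1 + of_nat n) * fact n * (b * p))"
      by (simp add: pochhammer_rec p_def)
    have 2: "?a (b + 1) (Suc n) = 1 / ((1 + of_nat n) * fact n * (p * (b + 1 + of_nat n)))"
      by (simp add: pochhammer_Suc p_def)
    \<comment> \<open>With t = b + 1 + n the numerator t - b of the difference is exactly n + 1,
      which cancels a factor of the factorial.\<close>
    have "1 / (m * k * (b * p)) - 1 / (m * k * (p * t))
        = 1 / (b * c) * (1 / (k * (p * t / c)))"
      if "m \<noteq> 0" "k \<noteq> 0" "t \<noteq> 0" "c \<noteq> 0" "m = t - b" for m k t c :: complex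
      using that(1-4) \<open>p \<noteq> 0\<close> \<open>b \<noteq> 0\<close>
      by (simp add: divide_simps) (simp add: that(5) algebra_simps)
    note 3 = this[of "1 + of_nat n" "fact n" "b + 1 + of_nat n" "b + 1"]
    have "1 + of_nat n \<noteq> (0 :: complex)" by (metis of_nat_Suc of_nat_eq_0_iff nat.distinct(1))
    then show ?thesis
      unfolding 1 2 p2 using nz1[of n] \<open>b + 1 \<noteq> 0\<close> by (intro 3) auto
  qed
  have "hyp01 b w - hyp01 (b + 1) w = (\<Sum>n. ?a b n * w ^ n - ?a (b + 1) n * w ^ n)"
    unfolding hyp01_def by (rule suminf_diff[OF summable_hyp01[OF assms] summable_hyp01[OF b1]])
  also have "\<dots> = (\<Sum>n. ?a b (Suc n) * w ^ Suc n - ?a (b + 1) (Suc n) * w ^ Suc n)"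
    using suminf_split_head[OF summable_diff[OF summable_hyp01[OF assms, of w] summable_hyp01[OF b1, of w]]]
    by (simp only: power_0 pochhammer_0 fact_0) simp
  also have "\<dots> = (\<Sum>n. w / (b * (b + 1)) * (?a (b + 2) n * w ^ n))"
  proof (rule suminf_cong)
    fix n
    have "?a b (Suc n) * w ^ Suc n - ?a (b + 1) (Suc n) * w ^ Suc n
        = (?a b (Suc n) - ?a (b + 1) (Suc n)) * w ^ Suc n" by (rule left_diff_distrib[symmetric])
    also have "\<dots> = w / (b * (b + 1)) * (?a (b + 2) n * w ^ n)"
    proof -
      have "1 / d * x * w ^ Suc n = w / d * (x * w ^ n)" for d x
        by simp
      then show ?thesis unfolding coeff .
    qed
    finally show "?a b (Suc n) * w ^ Suc n - ?a (b + 1) (Suc n) * w ^ Suc n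
        = w / (b * (b + 1)) * (?a (b + 2) n * w ^ n)" .
  qed
  also have "\<dots> = w / (b * (b + 1)) * hyp01 (b + 2) w"
    unfolding hyp01_def by (rule suminf_mult[OF summable_hyp01[OF b2]])
  finally show ?thesis by (simp only: diff_eq_eq add.commute)
qed

lemma holomorphic_hyp01: "b \<notin> \<int>\<^sub>\<le>\<^sub>0 \<Longrightarrow> hyp01 b holomorphic_on A"
  using DERIV_hyp01 by (intro holomorphic_on_subset[of _ UNIV A])
    (auto simp: holomorphic_on_open)

text \<open>A common zero of two contiguous functions propagates by the recurrence to all parameters
  b + n. Up to Pochhammer factors these values are the derivatives of \<open>hyp01 b\<close> at
  \<open>w\<close>, so \<open>hyp01 b\<close> would vanish identically, although it is 1 at
  0.\<close>

lemma hyp01_zero_simple: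
  assumes "b \<notin> \<int>\<^sub>\<le>\<^sub>0" "hyp01 b w = 0"
  shows "hyp01 (b + 1) w \<noteq> 0"
proof
  assume "hyp01 (b + 1) w = 0"
  have "w \<noteq> 0" using assms(2) by auto
  have nz: "b + of_nat n \<noteq> 0" for n
    using plus_of_nat_notin_nonpos_Ints[OF assms(1), of n] by auto
  have zero: "hyp01 (b + of_nat n) w = 0 \<and> hyp01 (b + of_nat (Suc n)) w = 0" for n
  proof (induction n)
    case (Suc n)
    have "b + of_nat n + 1 \<noteq> 0" "b + of_nat n \<noteq> 0" using nz[of "Suc n"] nz[of n] by (simp_all add: add_ac)
    have "b + of_nat n + 1 = b + of_nat (Suc n)" "b + of_nat n + 2 = b + of_nat (Suc (Suc n))"
      by simp_all
    then have "w / ((b + of_nat n) * (b + of_nat n + 1)) * hyp01 (b + of_nat (Suc (Suc n))) w = 0"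
      using hyp01_contiguous[OF plus_of_nat_notin_nonpos_Ints[OF assms(1), of n], of w] Suc
      by (simp only:) simp
    with \<open>w \<noteq> 0\<close> \<open>b + of_nat n \<noteq> 0\<close> \<open>b + of_nat n + 1 \<noteq> 0\<close> Suc show ?case by simp
  qed (use assms \<open>hyp01 (b + 1) w = 0\<close> in simp)
  have "(deriv ^^ n) (hyp01 b) = (\<lambda>z. hyp01 (b + of_nat n) z / pochhammer b n)" for n
  proof (induction n)
    case (Suc n)
    show ?case
    proof
      fix z
      have "((\<lambda>z. hyp01 (b + of_nat n) z / pochhammer b n) has_field_derivative
          hyp01 (b + of_nat n + 1) z / (b + of_nat n) / pochhammer b n) (at z)"
        by (intro DERIV_cdivide DERIV_hyp01 plus_of_nat_notin_nonpos_Ints assms)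
      then show "(deriv ^^ Suc n) (hyp01 b) z = hyp01 (b + of_nat (Suc n)) z / pochhammer b (Suc n)"
        using Suc by (simp add: DERIV_imp_deriv pochhammer_Suc add_ac mult.commute)
    qed
  qed simp
  then have "(deriv ^^ n) (hyp01 b) w = 0" for n using zero by simp
  then have "hyp01 b 0 = 0"
    by (intro holomorphic_fun_eq_0_on_connected[OF holomorphic_hyp01[OF assms(1)]
          open_UNIV connected_UNIV]) auto
  then show False by simp
qed

lemma genus_zero_hyp01:
  assumes "b \<notin> \<int>\<^sub>\<le>\<^sub>0"
  obtains C where "genus_zero (hyp01 b) 1 C"
proof -
  obtain C where "C \<ge> 0" "\<And>w. norm (hyp01 b w) \<le> exp (C * sqrt (norm w))"
    using summable_hyp01_and_growth[OF assms] by blast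
  moreover have "deriv (hyp01 b) w \<noteq> 0" if "hyp01 b w = 0" for w
    using hyp01_zero_simple[OF assms that] DERIV_hyp01[OF assms, of w] assms
    by (auto simp: DERIV_imp_deriv)
  ultimately have "genus_zero (hyp01 b) 1 C"
    by unfold_locales (auto intro: holomorphic_hyp01[OF assms])
  then show thesis by (rule that)
qed

section \<open>From the hypergeometric function to \<open>calI\<close>\<close>

text \<open>Gamma (\<alpha> + 1 + n) / Gamma (\<alpha> + 1) is a Pochhammer symbol; the results on
  \<open>hyp01\<close> transfer through w = z^2 / 4.\<close>

lemma calI_eq_hyp01:
  assumes "\<alpha> + 1 \<notin> \<int>\<^sub>\<le>\<^sub>0"
  shows "calI \<alpha> = (\<lambda>z. hyp01 (\<alpha> + 1) (z\<^sup>2 / 4))"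
proof
  fix z
  have nz: "Gamma (\<alpha> + 1) \<noteq> 0" using assms by (simp add: Gamma_eq_zero_iff)
  have eq: "1 / (fact n * pochhammer (\<alpha> + 1) n) * (z\<^sup>2 / 4) ^ n
      = Gamma (\<alpha> + 1) * ((z / 2) ^ (2 * n) / (fact n * Gamma (of_nat n + \<alpha> + 1)))" for n
  proof -
    have "of_nat n + \<alpha> + 1 = \<alpha> + 1 + of_nat n" by simp
    then show ?thesis
      using nz by (simp only: pochhammer_Gamma[OF assms] power_mult power_divide) simp
  qed
  have "summable (\<lambda>n. Gamma (\<alpha> + 1) * ((z / 2) ^ (2 * n) / (fact n * Gamma (of_nat n + \<alpha> + 1))))"
    using summable_hyp01[OF assms, of "z\<^sup>2 / 4"] unfolding eq .
  then have "summable (\<lambda>n. (z / 2) ^ (2 * n) / (fact n * Gamma (of_nat n + \<alpha> + 1)))"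
    using nz by (simp only: summable_cmult_iff) simp
  then show "calI \<alpha> z = hyp01 (\<alpha> + 1) (z\<^sup>2 / 4)"
    unfolding calI_def hyp01_def eq by (rule suminf_mult[symmetric])
qed

lemma DERIV_calI:
  assumes "\<alpha> + 1 \<notin> \<int>\<^sub>\<le>\<^sub>0"
  shows "(calI \<alpha> has_field_derivative z / (2 * (\<alpha> + 1)) * calI (\<alpha> + 1) z) (at z)"
proof -
  have "((\<lambda>z. hyp01 (\<alpha> + 1) (z\<^sup>2 / 4)) has_field_derivative
      hyp01 (\<alpha> + 1 + 1) (z\<^sup>2 / 4) / (\<alpha> + 1) * (z / 2)) (at z)"
    by (rule DERIV_chain2[OF DERIV_hyp01[OF assms]]) (auto intro!: derivative_eq_intros)
  moreover have "hyp01 (\<alpha> + 1 + 1) (z\<^sup>2 / 4) / (\<alpha> + 1) * (z / 2)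
      = z / (2 * (\<alpha> + 1)) * hyp01 (\<alpha> + 1 + 1) (z\<^sup>2 / 4)"
    by (simp add: mult_ac)
  ultimately show ?thesis
    by (simp only: calI_eq_hyp01[OF assms] calI_eq_hyp01[OF plus_1_notin_nonpos_Ints[OF assms]])
qed

text \<open>This is \<open>hyp01_contiguous\<close> in the variable z^2 / 4. It turns the quotient
  of \<open>calI \<alpha>\<close> by its derivative into a logarithmic derivative of
  \<open>calI (\<alpha> + 1)\<close> plus an elementary term.\<close>

lemma calI_contiguous:
  assumes "\<alpha> + 1 \<notin> \<int>\<^sub>\<le>\<^sub>0"
  shows "calI \<alpha> z = calI (\<alpha> + 1) z + z / (2 * (\<alpha> + 1)) * deriv (calI (\<alpha> + 1)) z"
proof -
  note 1 = plus_1_notin_nonpos_Ints[OF assms]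
  note 2 = plus_1_notin_nonpos_Ints[OF 1]
  have eq: "z\<^sup>2 / 4 / (c * d) * x = z / (2 * c) * (z / (2 * d) * x)" for c d x :: complex
    by (simp add: power2_eq_square)
  have "deriv (calI (\<alpha> + 1)) z = z / (2 * (\<alpha> + 1 + 1)) * hyp01 (\<alpha> + 1 + 1 + 1) (z\<^sup>2 / 4)"
    using DERIV_imp_deriv[OF DERIV_calI[OF 1], of z] by (simp only: calI_eq_hyp01[OF 2])
  moreover have "\<alpha> + 1 + 2 = \<alpha> + 1 + 1 + 1" by simp
  ultimately show ?thesis
    using hyp01_contiguous[OF assms, of "z\<^sup>2 / 4"]
    by (simp only: calI_eq_hyp01[OF assms] calI_eq_hyp01[OF 1] eq)
qed

subsection \<open>Principal value sums over the Bessel zeros\<close>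

lemma higher_deriv_sum_simple_poles:
  fixes c :: "'a \<Rightarrow> complex"
  assumes "finite J" "open B" "\<And>j. j \<in> J \<Longrightarrow> c j \<notin> B" "z \<in> B"
  shows "(deriv ^^ k) (\<lambda>z. \<Sum>j\<in>J. 1 / (c j - z)) z = (\<Sum>j\<in>J. fact k / (c j - z) ^ (k + 1))"
  using assms(4)
proof (induction k arbitrary: z)
  case (Suc k)
  have "((\<lambda>z. \<Sum>j\<in>J. fact k / (c j - z) ^ (k + 1)) has_field_derivative
      (\<Sum>j\<in>J. fact (Suc k) / (c j - z) ^ (Suc k + 1))) (at z)"
  proof (rule DERIV_sum)
    fix j assume "j \<in> J"
    then have "c j - z \<noteq> 0" using assms(3) Suc.prems by auto
    have "((\<lambda>z. inverse (c j - z)) has_field_derivative inverse (c j - z) ^ 2) (at z)"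
      using \<open>c j - z \<noteq> 0\<close> by (auto intro!: derivative_eq_intros simp: power2_eq_square)
    from DERIV_cmult[OF DERIV_power[OF this, of "Suc k"], of "fact k"]
    show "((\<lambda>z. fact k / (c j - z) ^ (k + 1)) has_field_derivative
        fact (Suc k) / (c j - z) ^ (Suc k + 1)) (at z)"
      by (simp add: divide_inverse power2_eq_square mult_ac distrib_left distrib_right flip: power_inverse)
  qed
  then have "((deriv ^^ k) (\<lambda>z. \<Sum>j\<in>J. 1 / (c j - z)) has_field_derivative
      (\<Sum>j\<in>J. fact (Suc k) / (c j - z) ^ (Suc k + 1))) (at z)"
    by (rule has_field_derivative_transform_within_open[OF _ assms(2) Suc.prems])
       (simp add: Suc.IH)
  then show ?case by (simp add: DERIV_imp_deriv)
qed simp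

lemma symmetric_pole_pair:
  fixes a z :: complex
  assumes "a\<^sup>2 \<noteq> z\<^sup>2"
  shows "1 / (a - z) + 1 / (- a - z) = 2 * z / (a\<^sup>2 - z\<^sup>2)"
proof -
  have eq: "a\<^sup>2 - z\<^sup>2 = (a - z) * (a + z)" "- a - z = - (a + z)"
    by (simp_all add: power2_eq_square algebra_simps)
  with assms have "a - z \<noteq> 0" "a + z \<noteq> 0" by auto
  then show ?thesis
    unfolding eq minus_divide_right[symmetric] by (simp add: divide_simps)
qed

text \<open>Grouping the indices n + 1 and - (n + 1) turns a principal value into an ordinary
  series, with absent indices contributing 0.\<close>

lemma pv_partial_eq_sum:
  assumes "0 \<notin> A"
  shows "pv_partial A f N = (\<Sum>n<N. (if int n + 1 \<in> A then f (int n + 1) else 0)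
      + (if - (int n + 1) \<in> A then f (- (int n + 1)) else 0))"
proof (induction N)
  case 0
  have "{j \<in> A. \<bar>j\<bar> \<le> int 0} = {}" using assms by auto
  then show ?case unfolding pv_partial_def by (simp only: sum.empty lessThan_0)
next
  case (Suc N)
  have fin: "finite {j \<in> A. \<bar>j\<bar> \<le> int N}"
    by (rule finite_subset[of _ "{- int N..int N}"]) auto
  have "{j \<in> A. \<bar>j\<bar> \<le> int (Suc N)} =
      {j \<in> A. \<bar>j\<bar> \<le> int N} \<union> ({int N + 1} \<inter> A \<union> {- (int N + 1)} \<inter> A)"
    by auto
  then have "pv_partial A f (Suc N) = pv_partial A f N + (sum f ({int N + 1} \<inter> A) + sum f ({- (int N + 1)} \<inter> A))"
    unfolding pv_partial_def
    by (simp only:) (subst sum.union_disjoint, use fin in auto)+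
  then show ?case by (simp add: Suc)
qed

lemma pv_partial_remove:
  assumes "l \<in> A" "nat \<bar>l\<bar> \<le> N"
  shows "pv_partial (A - {l}) f N = pv_partial A f N - f l"
proof -
  have "finite {j \<in> A. \<bar>j\<bar> \<le> int N}"
    by (rule finite_subset[of _ "{- int N..int N}"]) auto
  moreover have "{j \<in> A - {l}. \<bar>j\<bar> \<le> int N} = {j \<in> A. \<bar>j\<bar> \<le> int N} - {l}" by auto
  ultimately show ?thesis
    using assms by (simp add: pv_partial_def sum_diff1)
qed

section \<open>Enumeration of the Bessel zeros and the partial fraction expansion\<close>

locale bessel_zeros =
  fixes \<alpha> :: complex and s :: "int \<Rightarrow> complex"
  assumes alpha: "\<alpha> + 1 \<notin> \<int>\<^sub>\<le>\<^sub>0"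
    and enum: "bessel_zero_enum \<alpha> s"
begin

lemma alpha1: "\<alpha> + 1 + 1 \<notin> \<int>\<^sub>\<le>\<^sub>0"
  by (rule plus_1_notin_nonpos_Ints[OF alpha])

lemma alpha_ne: "\<alpha> + 1 \<noteq> 0"
  using alpha by auto

lemma bessel_zero_iff: "bessel_J_quot (\<alpha> + 1) x = 0 \<longleftrightarrow> hyp01 (\<alpha> + 1 + 1) (- (x\<^sup>2 / 4)) = 0"
proof -
  have "Gamma (\<alpha> + 1 + 1) \<noteq> 0" using alpha1 by (simp add: Gamma_eq_zero_iff)
  then show ?thesis
    using calI_eq_bessel_J_quot[of "\<alpha> + 1" "- \<i> * x"]
    by (simp add: calI_eq_hyp01[OF alpha1] power_mult_distrib)
qed

lemma calI_zero_iff: "calI (\<alpha> + 1) (\<i> * x) = 0 \<longleftrightarrow> x \<in> s ` (UNIV - {0})"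
proof -
  have "s ` (UNIV - {0}) = {x. bessel_J_quot (\<alpha> + 1) x = 0}"
    using enum by (simp add: bessel_zero_enum_def bij_betw_def)
  then show ?thesis
    using bessel_zero_iff[of x] by (simp add: calI_eq_hyp01[OF alpha1] power_mult_distrib)
qed

lemma s_minus: "s (- (int n + 1)) = - s (int n + 1)"
  using enum unfolding bessel_zero_enum_def by (metis le_add_same_cancel2 of_nat_0_le_iff)

lemma s_inj: "i \<noteq> 0 \<Longrightarrow> j \<noteq> 0 \<Longrightarrow> s i = s j \<Longrightarrow> i = j"
  using enum by (auto simp: bessel_zero_enum_def bij_betw_def dest: inj_onD)

lemma s_ne_0: "j \<noteq> 0 \<Longrightarrow> s j \<noteq> 0"
  using calI_zero_iff[of 0] by (auto simp: calI_eq_hyp01[OF alpha1])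

text \<open>The map x to -(x^2 / 4) identifies s_j with s_(-j) and no other zeros, so the positive
  indices, written n + 1, list each zero of the hypergeometric function once.\<close>

lemma bij_betw_squares:
  "bij_betw (\<lambda>n. - ((s (int n + 1))\<^sup>2 / 4)) UNIV {w. hyp01 (\<alpha> + 1 + 1) w = 0}"
  unfolding bij_betw_def
proof (intro conjI inj_onI equalityI subsetI)
  fix m n :: nat assume "- ((s (int m + 1))\<^sup>2 / 4) = - ((s (int n + 1))\<^sup>2 / 4)"
  then consider "s (int m + 1) = s (int n + 1)" | "s (int m + 1) = s (- (int n + 1))"
    using s_minus[of n] by (auto simp: power2_eq_iff)
  then show "m = n"
    by cases (use s_inj[of "int m + 1" "int n + 1"] s_inj[of "int m + 1" "- (int n + 1)"] in simp_all)
next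
  fix w assume "w \<in> range (\<lambda>n. - ((s (int n + 1))\<^sup>2 / 4))"
  then show "w \<in> {w. hyp01 (\<alpha> + 1 + 1) w = 0}"
    using calI_zero_iff by (auto simp: calI_eq_hyp01[OF alpha1] power_mult_distrib)
next
  fix w assume w: "w \<in> {w. hyp01 (\<alpha> + 1 + 1) w = 0}"
  define x where "x = csqrt (- 4 * w)"
  have x: "- (x\<^sup>2 / 4) = w" by (simp add: x_def)
  with w have "calI (\<alpha> + 1) (\<i> * x) = 0"
    by (simp add: calI_eq_hyp01[OF alpha1] power_mult_distrib)
  then obtain j where j: "j \<noteq> 0" "x = s j" using calI_zero_iff[of x] by blast
  define n where "n = nat \<bar>j\<bar> - 1"
  have "j = int n + 1 \<or> j = - (int n + 1)" using j(1) by (auto simp: n_def)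
  then have "x\<^sup>2 = (s (int n + 1))\<^sup>2" using j(2) s_minus[of n] by (metis power2_minus)
  with x show "w \<in> range (\<lambda>n. - ((s (int n + 1))\<^sup>2 / 4))" by auto
qed

text \<open>The summability of the inverse zeros is carried along the bijection; it provides the
  Weierstrass majorant and shows that the zeros tend to infinity.\<close>

lemma summable_inverse_squares: "summable (\<lambda>n. 1 / (norm (s (int n + 1)))\<^sup>2)"
proof -
  obtain C where "genus_zero (hyp01 (\<alpha> + 1 + 1)) 1 C"
    using genus_zero_hyp01[OF alpha1] .
  from genus_zero.summable_inverse_zeros[OF this]
  have "(\<lambda>n. 1 / norm (- ((s (int n + 1))\<^sup>2 / 4))) summable_on UNIV"
    using summable_on_reindex_bij_betw[OF bij_betw_squares, of "\<lambda>w. 1 / norm w"] by simp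
  then have "summable (\<lambda>n. 1 / norm (- ((s (int n + 1))\<^sup>2 / 4)))"
    by (rule summable_on_imp_summable)
  then have "summable (\<lambda>n. 1 / 4 * (1 / norm (- ((s (int n + 1))\<^sup>2 / 4))))"
    by (rule summable_mult)
  then show ?thesis by (simp add: norm_divide norm_power)
qed

text \<open>With w = - (z^2 / 4) the pair 1 / (t - z) + 1 / (- t - z) equals z / 2 times 1 / (w +
  t^2 / 4), so the principal value is z / 2 times the logarithmic derivative of
  \<open>hyp01 (\<alpha> + 1 + 1)\<close> at \<open>w\<close>. The contiguous relation rewrites that
  through \<open>calI \<alpha>\<close>.\<close>

lemma pv_log_deriv:
  assumes "calI (\<alpha> + 1) (\<i> * z) \<noteq> 0" "z \<noteq> 0"
  shows "pv_partial (UNIV - {0}) (\<lambda>j. 1 / (s j - z))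
    \<longlonglongrightarrow> 2 * (1 + \<alpha>) / z - \<i> * calI \<alpha> (\<i> * z) / deriv (calI \<alpha>) (\<i> * z)"
proof -
  let ?F = "hyp01 (\<alpha> + 1 + 1)" and ?Y = "calI (\<alpha> + 1)"
  define t where "t = (\<lambda>n. s (int n + 1))"
  obtain C where "genus_zero ?F 1 C"
    using genus_zero_hyp01[OF alpha1] .
  then interpret genus_zero ?F 1 C .
  define w where "w = - (z\<^sup>2 / 4)"
  have Y: "?Y (\<i> * z) = ?F w"
    by (simp add: calI_eq_hyp01[OF alpha1] power_mult_distrib w_def)
  have dY: "deriv ?Y (\<i> * z) = \<i> * z / 2 * deriv ?F w"
  proof -
    have "calI (\<alpha> + 1 + 1) (\<i> * z) = hyp01 (\<alpha> + 1 + 1 + 1) w"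
      unfolding calI_eq_hyp01[OF plus_1_notin_nonpos_Ints[OF alpha1]] w_def
      by (simp add: power_mult_distrib)
    then show ?thesis
      by (simp only: DERIV_imp_deriv[OF DERIV_calI[OF alpha1]] DERIV_imp_deriv[OF DERIV_hyp01[OF alpha1]]
          divide_simps) (simp add: mult_ac)
  qed
  have "((\<lambda>x. 1 / (w - x)) has_sum deriv ?F w / ?F w) {x. ?F x = 0}"
    using assms(1) Y by (intro has_sum_log_deriv) simp
  then have "((\<lambda>n. 1 / (w - - ((s (int n + 1))\<^sup>2 / 4))) has_sum deriv ?F w / ?F w) UNIV"
    using has_sum_reindex_bij_betw[OF bij_betw_squares, of "\<lambda>x. 1 / (w - x)"] by simp
  then have "(\<lambda>n. z / 2 * (1 / (w - - ((t n)\<^sup>2 / 4)))) sums (z / 2 * (deriv ?F w / ?F w))"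
    unfolding t_def by (intro sums_mult has_sum_imp_sums)
  moreover have "z / 2 * (1 / (w - - ((t n)\<^sup>2 / 4))) = 1 / (t n - z) + 1 / (- t n - z)" for n
  proof -
    have "t n \<in> s ` (UNIV - {0})" "- t n \<in> s ` (UNIV - {0})"
      using s_minus[of n] by (auto simp: t_def intro: image_eqI[of _ _ "- (int n + 1)"])
    moreover have "z \<notin> s ` (UNIV - {0})"
      using assms(1) calI_zero_iff[of z] by simp
    ultimately have "t n \<noteq> z" "- t n \<noteq> z" by metis+
    then have "(t n)\<^sup>2 \<noteq> z\<^sup>2" by (auto simp: power2_eq_iff)
    moreover have "z / 2 * (1 / (w - - ((t n)\<^sup>2 / 4))) = 2 * z / ((t n)\<^sup>2 - z\<^sup>2)"
      by (simp add: w_def field_simps)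
    ultimately show ?thesis by (metis symmetric_pole_pair)
  qed
  ultimately have "(\<lambda>N. \<Sum>n<N. 1 / (t n - z) + 1 / (- t n - z)) \<longlonglongrightarrow> z / 2 * (deriv ?F w / ?F w)"
    by (simp add: sums_def)
  moreover have "pv_partial (UNIV - {0}) (\<lambda>j. 1 / (s j - z)) = (\<lambda>N. \<Sum>n<N. 1 / (t n - z) + 1 / (- t n - z))"
    unfolding t_def s_minus[symmetric]
    by (rule ext, subst pv_partial_eq_sum) (auto intro!: sum.cong)
  moreover have "z / 2 * (deriv ?F w / ?F w)
      = 2 * (1 + \<alpha>) / z - \<i> * calI \<alpha> (\<i> * z) / deriv (calI \<alpha>) (\<i> * z)"
  proof -
    have "deriv ?F w = 2 * deriv ?Y (\<i> * z) / (\<i> * z)"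
      unfolding dY using assms(2) by simp
    moreover have "deriv (calI \<alpha>) (\<i> * z) = \<i> * z / (2 * (\<alpha> + 1)) * ?Y (\<i> * z)"
      by (rule DERIV_imp_deriv[OF DERIV_calI[OF alpha]])
    moreover have "calI \<alpha> (\<i> * z) = ?Y (\<i> * z) + \<i> * z / (2 * (\<alpha> + 1)) * deriv ?Y (\<i> * z)"
      by (rule calI_contiguous[OF alpha])
    \<comment> \<open>The summand \<open>y\<close> in the numerator produces 2 * a / z, which
      cancels; what remains is - \<i> times the logarithmic derivative d / y.\<close>
    moreover have "z / 2 * (2 * d / (\<i> * z) / y)
        = 2 * a / z - \<i> * (y + \<i> * z / (2 * a) * d) / (\<i> * z / (2 * a) * y)"
      if "y \<noteq> 0" "a \<noteq> 0" for d y a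
      using that assms(2) by (simp add: field_simps)
    ultimately show ?thesis
      unfolding Y[symmetric] using assms(1) alpha_ne by (simp only: add.commute[of 1])
  qed
  ultimately show ?thesis by simp
qed

text \<open>
  If \<open>z0 = s l\<close> with \<open>l\<close> omitted from \<open>A\<close>, then \<open>H\<close> is the holomorphic extension across \<open>z0\<close> of
  the logarithmic derivative with its pole removed.
\<close>

lemma pv_local:
  assumes A: "A \<subseteq> UNIV - {0}" "finite (UNIV - {0} - A)" and z0: "z0 \<notin> s ` A" "z0 \<noteq> 0"
  obtains r H where "r > 0" "0 \<notin> ball z0 r"
    "\<And>z. z \<in> ball z0 r \<Longrightarrow> z \<noteq> z0 \<Longrightarrow> calI (\<alpha> + 1) (\<i> * z) \<noteq> 0"
    "H holomorphic_on ball z0 r"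
    "\<And>z. z \<in> ball z0 r \<Longrightarrow> pv_partial A (\<lambda>j. 1 / (s j - z)) \<longlonglongrightarrow> H z"
    "\<And>k. pv_partial A (\<lambda>j. 1 / (s j - z0) ^ (k + 1)) \<longlonglongrightarrow> fps_nth (fps_expansion H z0) k"
proof -
  let ?y = "\<lambda>z. calI (\<alpha> + 1) (\<i> * z)"
  have "?y holomorphic_on UNIV"
    unfolding calI_eq_hyp01[OF alpha1]
    by (rule holomorphic_on_compose_gen[OF _ holomorphic_hyp01[OF alpha1, of UNIV], unfolded o_def])
       (auto intro!: holomorphic_intros)
  moreover have "?y 0 \<noteq> 0" by (simp add: calI_eq_hyp01[OF alpha1])
  ultimately have "eventually (\<lambda>z. ?y z \<noteq> 0 \<and> z \<in> UNIV) (at z0)"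
    by (intro non_zero_neighbour_alt[of _ _ _ 0]) auto
  then obtain e where e: "e > 0" "\<And>z. z \<noteq> z0 \<Longrightarrow> dist z z0 < e \<Longrightarrow> ?y z \<noteq> 0"
    unfolding eventually_at by auto
  \<comment> \<open>The bound by norm z0 keeps the origin, where 1 / z is singular, outside the
    ball.\<close>
  define r where "r = min e (norm z0)"
  have r: "r > 0" "0 \<notin> ball z0 r" using e(1) z0(2) by (simp_all add: r_def)
  have ynz: "?y z \<noteq> 0" if "z \<in> ball z0 r" "z \<noteq> z0" for z
    using e(2)[OF that(2)] that(1) by (simp add: r_def dist_commute)
  have no_pole: "s j \<notin> ball z0 r" if "j \<in> A" for j
    using ynz[of "s j"] calI_zero_iff[of "s j"] that A(1) z0(1) by auto
  have "0 \<notin> A" using A(1) by auto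
  define g where "g = (\<lambda>n z. (if int n + 1 \<in> A then 1 / (s (int n + 1) - z) else 0)
      + (if - (int n + 1) \<in> A then 1 / (s (- (int n + 1)) - z) else 0))"
  define P where "P = (\<lambda>N z. pv_partial A (\<lambda>j. 1 / (s j - z)) N)"
  have P_eq: "P = (\<lambda>N z. \<Sum>n<N. g n z)"
    unfolding P_def g_def by (intro ext pv_partial_eq_sum[OF \<open>0 \<notin> A\<close>])
  define R where "R = norm z0 + r"
  have "R > 0" using r(1) by (simp add: R_def add_nonneg_pos)
  have ev_A: "\<forall>\<^sub>F n in sequentially. int n + 1 \<in> A \<and> - (int n + 1) \<in> A"
  proof -
    have "bdd_above (abs ` (UNIV - {0} - A))" using A(2) by simp
    then obtain b where b: "\<And>j. j \<noteq> 0 \<Longrightarrow> j \<notin> A \<Longrightarrow> \<bar>j\<bar> \<le> b"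
      unfolding bdd_above_def by blast
    have "int n + 1 \<in> A \<and> - (int n + 1) \<in> A" if "n \<ge> nat b" for n
      using b[of "int n + 1"] b[of "- (int n + 1)"] that by fastforce
    then show ?thesis unfolding eventually_sequentially by blast
  qed
  have ev_large: "\<forall>\<^sub>F n in sequentially. 2 * R\<^sup>2 < (norm (s (int n + 1)))\<^sup>2"
  proof -
    have "\<forall>\<^sub>F n in sequentially. 1 / (norm (s (int n + 1)))\<^sup>2 < 1 / (2 * R\<^sup>2)"
      using summable_LIMSEQ_zero[OF summable_inverse_squares] \<open>R > 0\<close>
      by (intro order_tendstoD) auto
    then show ?thesis
    proof (rule eventually_mono)
      fix n assume "1 / (norm (s (int n + 1)))\<^sup>2 < 1 / (2 * R\<^sup>2)"
      moreover have "s (int n + 1) \<noteq> 0" by (intro s_ne_0) simp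
      ultimately show "2 * R\<^sup>2 < (norm (s (int n + 1)))\<^sup>2"
        using \<open>R > 0\<close> by (simp add: divide_simps)
    qed
  qed
  \<comment> \<open>For large t the paired term is 2 * z / (t^2 - z^2) with norm (t^2 - z^2) \<ge>
    (norm t)^2 / 2, which gives a summable majorant on the whole ball.\<close>
  have "\<forall>\<^sub>F n in sequentially. \<forall>z\<in>ball z0 r. norm (g n z) \<le> 4 * R * (1 / (norm (s (int n + 1)))\<^sup>2)"
    using ev_A ev_large
  proof eventually_elim
    case (elim n)
    let ?t = "s (int n + 1)"
    show ?case
    proof
      fix z assume "z \<in> ball z0 r"
      then have z: "norm z \<le> R"
        using norm_triangle_ineq2[of z z0] by (simp add: R_def dist_norm norm_minus_commute)
      then have z2: "(norm z)\<^sup>2 \<le> R\<^sup>2" by (intro power_mono) auto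
      have ge: "(norm ?t)\<^sup>2 / 2 \<le> norm (?t\<^sup>2 - z\<^sup>2)"
        using norm_triangle_ineq2[of "?t\<^sup>2" "z\<^sup>2"] z2 elim by (simp add: norm_power)
      have pos: "(norm ?t)\<^sup>2 > 0" using elim \<open>R > 0\<close> by (smt (verit) zero_le_power2)
      have "?t\<^sup>2 - z\<^sup>2 \<noteq> 0" using ge pos by auto
      then have "g n z = 2 * z / (?t\<^sup>2 - z\<^sup>2)"
        using elim symmetric_pole_pair[of ?t z] unfolding g_def s_minus by simp
      then have "norm (g n z) = 2 * norm z / norm (?t\<^sup>2 - z\<^sup>2)"
        by (simp add: norm_divide norm_mult)
      also have "\<dots> \<le> 2 * R / ((norm ?t)\<^sup>2 / 2)"
        using z ge pos \<open>R > 0\<close> by (intro frac_le) auto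
      finally show "norm (g n z) \<le> 4 * R * (1 / (norm ?t)\<^sup>2)" by simp
    qed
  qed
  from Weierstrass_m_test_ev[OF this summable_mult[OF summable_inverse_squares]]
  have unif: "uniform_limit (ball z0 r) P (\<lambda>z. \<Sum>n. g n z) sequentially"
    unfolding P_eq .
  define H where "H = (\<lambda>z. \<Sum>n. g n z)"
  have fin: "finite {j \<in> A. \<bar>j\<bar> \<le> int N}" for N
    by (rule finite_subset[of _ "{- int N..int N}"]) auto
  have holP: "P N holomorphic_on ball z0 r" for N
    unfolding P_def pv_partial_def using no_pole by (intro holomorphic_intros) auto
  have holH: "H holomorphic_on ball z0 r"
  proof (rule holomorphic_uniform_sequence[OF open_ball holP])
    fix x assume "x \<in> ball z0 r"
    then obtain d where "d > 0" "cball x d \<subseteq> ball z0 r"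
      using open_contains_cball[of "ball z0 r"] open_ball by blast
    then show "\<exists>d>0. cball x d \<subseteq> ball z0 r \<and> uniform_limit (cball x d) P H sequentially"
      using unif uniform_limit_on_subset unfolding H_def by blast
  qed
  have lim: "pv_partial A (\<lambda>j. 1 / (s j - z)) \<longlonglongrightarrow> H z" if "z \<in> ball z0 r" for z
    using tendsto_uniform_limitI[OF unif that] by (simp add: P_def H_def)
  have "pv_partial A (\<lambda>j. 1 / (s j - z0) ^ (k + 1)) \<longlonglongrightarrow> fps_nth (fps_expansion H z0) k" for k
  proof -
    \<comment> \<open>Uniform convergence on the ball passes to all derivatives at the centre, which
      identifies the limits as Taylor coefficients of \<open>H\<close>.\<close>
    have "(\<lambda>N. (deriv ^^ k) (P N) z0) \<longlonglongrightarrow> (deriv ^^ k) H z0"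
      using higher_deriv_complex_uniform_limit[OF unif, of z0 k] holP r(1)
      by (simp add: H_def)
    moreover have "(deriv ^^ k) (P N) z0 = fact k * pv_partial A (\<lambda>j. 1 / (s j - z0) ^ (k + 1)) N" for N
      unfolding P_def pv_partial_def
      by (subst higher_deriv_sum_simple_poles[OF fin open_ball[of z0 r]])
         (use no_pole r(1) in \<open>auto simp: sum_distrib_left\<close>)
    ultimately have "(\<lambda>N. fact k * pv_partial A (\<lambda>j. 1 / (s j - z0) ^ (k + 1)) N) \<longlonglongrightarrow> (deriv ^^ k) H z0"
      by simp
    from tendsto_divide[OF this tendsto_const[of "fact k"]]
    have "(\<lambda>N. fact k * pv_partial A (\<lambda>j. 1 / (s j - z0) ^ (k + 1)) N / fact k)
        \<longlonglongrightarrow> fps_nth (fps_expansion H z0) k"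
      by (simp only: fps_expansion_def fps_nth_Abs_fps) simp
    then show ?thesis by (simp only: nonzero_mult_div_cancel_left fact_nonzero not_False_eq_True)
  qed
  then show thesis using that r ynz holH lim by blast
qed

end

subsection \<open>Comparison of Taylor coefficients\<close>

lemma higher_deriv_inverse_id:
  fixes z :: complex
  assumes "z \<noteq> 0"
  shows "(deriv ^^ k) (\<lambda>z. 1 / z) z = fact k * (-1) ^ k / z ^ (k + 1)"
proof -
  have "(\<lambda>z::complex. 1 / z) = (\<lambda>z. - 1 * (\<Sum>j\<in>{0}. 1 / (j - z)))" by simp
  then have "(deriv ^^ k) (\<lambda>z. 1 / z) z = (deriv ^^ k) (\<lambda>z. - 1 * (\<Sum>j\<in>{0}. 1 / (j - z))) z"
    by (rule arg_cong)
  also have "\<dots> = - 1 * (deriv ^^ k) (\<lambda>z. \<Sum>j\<in>{0}. 1 / (j - z)) z"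
    by (rule higher_deriv_cmult[of _ "- {0}"]) (use assms in \<open>auto intro!: holomorphic_intros\<close>)
  also have "\<dots> = - 1 * (\<Sum>j\<in>{0}. fact k / (j - z) ^ (k + 1))"
    by (subst higher_deriv_sum_simple_poles[of _ "- {0}"]) (use assms in auto)
  also have "\<dots> = fact k * (-1) ^ k / z ^ (k + 1)"
    by (simp add: uminus_power_if)
  finally show ?thesis .
qed

text \<open>The Taylor coefficients of c / z at z0 are (-1)^j * c / z0^(j + 1); for c = 2 * (1 +
  \<alpha>) this is the term subtracted from the sums in the recurrences.\<close>

lemma fps_nth_expansion_diff_pole:
  fixes H :: "complex \<Rightarrow> complex"
  assumes "H holomorphic_on ball z0 r" "r > 0" "0 \<notin> ball z0 r"
  shows "fps_nth (fps_expansion (\<lambda>z. H z - c * (1 / z)) z0) j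
    = fps_nth (fps_expansion H z0) j - (-1) ^ j * c / z0 ^ (j + 1)"
proof -
  have inv: "(\<lambda>z. 1 / z) holomorphic_on ball z0 r"
    using assms(3) by (intro holomorphic_intros) auto
  have "z0 \<noteq> 0" using assms by auto
  have "(deriv ^^ j) (\<lambda>z. H z - c * (1 / z)) z0
      = (deriv ^^ j) H z0 - (deriv ^^ j) (\<lambda>z. c * (1 / z)) z0"
    using assms inv by (intro higher_deriv_diff[of _ "ball z0 r"] holomorphic_intros) auto
  also have "(deriv ^^ j) (\<lambda>z. c * (1 / z)) z0 = c * (deriv ^^ j) (\<lambda>z. 1 / z) z0"
    using assms inv by (intro higher_deriv_cmult[of _ "ball z0 r"]) auto
  finally show ?thesis
    using \<open>z0 \<noteq> 0\<close> by (simp add: fps_expansion_def higher_deriv_inverse_id diff_divide_distrib mult_ac)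
qed

text \<open>Splitting \<i>^(k + 1) into \<i>^(k - j) * \<i>^(j + 1) turns the stated recurrence sum
  into the coefficient of a Cauchy product; substituting \<i> * z in a Taylor series supplies the
  factor \<i>^(k - j).\<close>

lemma recurrence_sum_rescale:
  fixes D c :: "nat \<Rightarrow> complex"
  shows "(\<Sum>j=0..k. D (k - j + 1) / (\<i> ^ (j + 1) * fact (k - j)) * c j) * \<i> ^ (k + 1)
    = (\<Sum>j=0..k. c j * (\<i> ^ (k - j) * D (k - j + 1) / fact (k - j)))"
  unfolding sum_distrib_right
proof (rule sum.cong[OF refl])
  fix j assume "j \<in> {0..k}"
  then have "\<i> ^ (k + 1) = \<i> ^ (k - j) * \<i> ^ (j + 1)"
    by (simp flip: power_add power_Suc)
  then show "D (k - j + 1) / (\<i> ^ (j + 1) * fact (k - j)) * c j * \<i> ^ (k + 1)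
      = c j * (\<i> ^ (k - j) * D (k - j + 1) / fact (k - j))"
    by (simp only:) (simp del: power_Suc)
qed

text \<open>Here \<open>d2\<close>, \<open>d3\<close>, \<open>d4\<close> stand for derivatives of
  \<open>calI \<alpha>\<close> at \<i> * u for a Bessel zero \<open>u\<close>, and
  \<open>c0\<close>, \<open>c1\<close> for the corrected sums. The differential equation makes
  \<open>d3\<close> and \<open>d4\<close> multiples of \<open>d2\<close>, so \<open>d2\<close>
  cancels from both recurrences.\<close>

lemma bessel_zero_algebra:
  fixes u d2 d3 d4 c0 c1 \<alpha> :: complex
  assumes "u \<noteq> 0" "d2 \<noteq> 0"
    and d3: "\<i> * u * d3 = - (2 * \<alpha> + 1) * d2"
    and d4: "\<i> * u * d4 = \<i> * u * d2 - (2 * \<alpha> + 3) * d3"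
    and c0: "d2 / \<i> * c0 = d3 / 2"
    and c1: "d3 / (2 * \<i>) * c0 - d2 * c1 = d4 / 6 - d2 / 2"
  shows "2 * u * c0 = - (2 * \<alpha> + 1)"
    and "12 * u\<^sup>2 * c1 = 4 * u\<^sup>2 + (2 * \<alpha> + 1) * (3 - 2 * \<alpha>)"
proof -
  define b where "b = 2 * \<alpha> + 1"
  have i: "\<i> * (\<i> * x) = - x" for x by (simp flip: mult.assoc)
  have d3': "u * d3 = \<i> * b * d2"
    using arg_cong[OF d3[folded b_def], of "\<lambda>x. - \<i> * x"] by (simp add: mult.assoc i)
  have d4': "u\<^sup>2 * d4 = (u\<^sup>2 - (b + 2) * b) * d2"
  proof -
    have "u * d4 = u * d2 + \<i> * (b + 2) * d3"
      using arg_cong[OF d4, of "\<lambda>x. - \<i> * x"] by (simp add: b_def mult.assoc i right_diff_distrib)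
    then have "u * (u * d4) = u * u * d2 + \<i> * (b + 2) * (u * d3)"
      by (simp add: algebra_simps)
    then show ?thesis
      unfolding d3' by (simp add: power2_eq_square algebra_simps i)
  qed
  have "d2 * c0 = \<i> * (d2 / \<i> * c0)" by (simp add: i mult.assoc)
  then have "2 * d2 * c0 = \<i> * d3" unfolding c0 by (simp add: mult_ac)
  then have "2 * d2 * c0 * u = \<i> * (u * d3)" by simp
  then have "d2 * (2 * u * c0) = d2 * (- b)"
    unfolding d3' by (simp add: i mult_ac)
  then have uc0: "2 * u * c0 = - b" using \<open>d2 \<noteq> 0\<close> by (metis mult_left_cancel)
  then show "2 * u * c0 = - (2 * \<alpha> + 1)" unfolding b_def .
  have "- (\<i> * d3 * c0) / 2 - d2 * c1 = d4 / 6 - d2 / 2"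
  proof -
    have "d3 / (2 * \<i>) = - (\<i> * d3) / 2" by (simp add: divide_eq_eq i mult_ac)
    then show ?thesis using c1 by (simp add: mult.assoc)
  qed
  then have "12 * u\<^sup>2 * (- (\<i> * d3 * c0) / 2 - d2 * c1) = 12 * u\<^sup>2 * (d4 / 6 - d2 / 2)"
    by (rule arg_cong)
  then have "- (3 * \<i> * (u * d3) * (2 * u * c0)) - 12 * u\<^sup>2 * c1 * d2 = 2 * (u\<^sup>2 * d4) - 6 * u\<^sup>2 * d2"
    by (simp add: power2_eq_square algebra_simps)
  then have "12 * u\<^sup>2 * c1 * d2 = (4 * u\<^sup>2 + b * (4 - b)) * d2"
    unfolding d3' d4' uc0 by (simp add: algebra_simps i)
  then have "12 * u\<^sup>2 * c1 = 4 * u\<^sup>2 + b * (4 - b)" using \<open>d2 \<noteq> 0\<close> by (metis mult_right_cancel)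
  then show "12 * u\<^sup>2 * c1 = 4 * u\<^sup>2 + (2 * \<alpha> + 1) * (3 - 2 * \<alpha>)"
    by (simp add: b_def)
qed

section \<open>Recurrences at regular points and at zeros\<close>

context bessel_zeros
begin

lemma holomorphic_calI: "calI \<alpha> holomorphic_on A"
  using DERIV_calI[OF alpha]
  by (intro holomorphic_on_subset[of _ UNIV A]) (auto simp: holomorphic_on_open)

lemma has_fps_expansion_deriv_calI:
  "(\<lambda>x. (deriv ^^ m) (calI \<alpha>) (\<i> * (z0 + x))) has_fps_expansion
     Abs_fps (\<lambda>n. \<i> ^ n * (deriv ^^ (n + m)) (calI \<alpha>) (\<i> * z0) / fact n)"
proof -
  let ?f = "(deriv ^^ m) (calI \<alpha>)"
  have hol: "?f holomorphic_on UNIV" by (intro holomorphic_higher_deriv holomorphic_calI) auto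
  have "(\<lambda>z. ?f (\<i> * z)) holomorphic_on UNIV"
    by (rule holomorphic_on_compose_gen[OF _ hol, unfolded o_def]) (auto intro!: holomorphic_intros)
  then have "(\<lambda>z. ?f (\<i> * z)) analytic_on {z0}"
    using analytic_at by blast
  then have "(\<lambda>x. ?f (\<i> * (z0 + x))) has_fps_expansion fps_expansion (\<lambda>z. ?f (\<i> * z)) z0"
    by (rule analytic_at_imp_has_fps_expansion)
  moreover have "(deriv ^^ n) (\<lambda>z. ?f (\<i> * z)) z0 = \<i> ^ n * (deriv ^^ (n + m)) (calI \<alpha>) (\<i> * z0)" for n
    using higher_deriv_compose_linear[OF hol open_UNIV open_UNIV, of z0 \<i> n]
    by (simp add: funpow_add)
  ultimately show ?thesis by (simp add: fps_expansion_def)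
qed

lemma deriv_calI_ne_0:
  assumes "calI (\<alpha> + 1) z \<noteq> 0" "z \<noteq> 0"
  shows "deriv (calI \<alpha>) z \<noteq> 0"
  using assms alpha_ne by (simp add: DERIV_imp_deriv[OF DERIV_calI[OF alpha]] del: distrib_left_numeral)

text \<open>Near \<open>u\<close> the generating function of the sums, minus 2 * (1 + \<alpha>) / z,
  equals - \<i> * I / I' with I and I' the values of \<open>calI \<alpha>\<close> and its derivative
  at \<i> * z. Up to a constant this is the quotient defining the Calogero-Dunkl numbers; cleared of
  the denominator it becomes a power series identity whose coefficients give the recurrence.\<close>

lemma calI_regular_point:
  assumes u: "u \<notin> insert 0 (s ` (UNIV - {0}))"
  shows "pv_summable (UNIV - {0}) (\<lambda>j. 1 / (s j - u) ^ (k + 1))"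
    and "eta s k u = 2 * (1 + \<alpha>) *
        ((-1) ^ k / u ^ (k + 1) - \<i> ^ (k + 1) * calogero_dunkl k \<alpha> (\<i> * u))"
    and "(\<Sum>j=0..k. (deriv ^^ (k - j + 1)) (calI \<alpha>) (\<i> * u) / (\<i> ^ (j + 1) * fact (k - j)) *
          (eta s j u - (-1) ^ j * 2 * (1 + \<alpha>) / u ^ (j + 1)))
        = - ((deriv ^^ k) (calI \<alpha>) (\<i> * u) / fact k)"
proof -
  have u0: "UNIV - {0} \<subseteq> UNIV - {0::int}" "finite (UNIV - {0} - (UNIV - {0::int}))"
    "u \<notin> s ` (UNIV - {0})" "u \<noteq> 0"
    using u by simp_all
  obtain r H where r: "r > 0" "0 \<notin> ball u r"
    and nz: "\<And>z. z \<in> ball u r \<Longrightarrow> z \<noteq> u \<Longrightarrow> calI (\<alpha> + 1) (\<i> * z) \<noteq> 0"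
    and H: "H holomorphic_on ball u r"
      "\<And>z. z \<in> ball u r \<Longrightarrow> pv_partial (UNIV - {0}) (\<lambda>j. 1 / (s j - z)) \<longlonglongrightarrow> H z"
    and lim: "\<And>k. pv_partial (UNIV - {0}) (\<lambda>j. 1 / (s j - u) ^ (k + 1)) \<longlonglongrightarrow> fps_nth (fps_expansion H u) k"
    by (rule pv_local[OF u0], rule that)
  show "pv_summable (UNIV - {0}) (\<lambda>j. 1 / (s j - u) ^ (k + 1))"
    unfolding pv_summable_def using lim by (rule convergentI)
  have eta: "eta s k u = fps_nth (fps_expansion H u) k" for k
    unfolding eta_def pv_sum_def using lim by (rule limI)
  define e where "e = (\<lambda>z. H z - 2 * (1 + \<alpha>) * (1 / z))"
  have eta_diff: "fps_nth (fps_expansion e u) j = eta s j u - (-1) ^ j * 2 * (1 + \<alpha>) / u ^ (j + 1)" for j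
    unfolding e_def eta fps_nth_expansion_diff_pole[OF H(1) r] by simp
  have hol_e: "e holomorphic_on ball u r"
    unfolding e_def using H(1) r(2) by (intro holomorphic_intros) auto
  have Y: "calI (\<alpha> + 1) (\<i> * z) \<noteq> 0" and z: "z \<noteq> 0" if "z \<in> ball u r" for z
    using nz[OF that] calI_zero_iff[of u] u r(2) that by auto
  have e_eq: "e z = - \<i> * calI \<alpha> (\<i> * z) / deriv (calI \<alpha>) (\<i> * z)" if "z \<in> ball u r" for z
    using LIMSEQ_unique[OF H(2)[OF that] pv_log_deriv[OF Y[OF that] z[OF that]]]
    by (simp add: e_def)
  have "e analytic_on {u}"
    using hol_e r(1) analytic_at[of e u] by (meson centre_in_ball open_ball)
  then have fps_e: "(\<lambda>x. e (u + x)) has_fps_expansion fps_expansion e u"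
    by (rule analytic_at_imp_has_fps_expansion)
  have ev: "\<forall>\<^sub>F x in nhds 0. u + x \<in> ball u r"
    using r(1) eventually_nhds_in_open[of "ball 0 r" "0::complex"] by (simp add: dist_norm)

  \<comment> \<open>The generating function of the Calogero-Dunkl numbers for v = \<i> * u. The
    value of \<open>e\<close> at u + x corresponds to t = \<i> * x, hence the factor \<i> ^ k
    below.\<close>
  define Q where "Q = (\<lambda>t. calI \<alpha> (t + \<i> * u) / ((t + \<i> * u) * calI (\<alpha> + 1) (t + \<i> * u)))"
  have Q_arg: "t + \<i> * u = \<i> * (u - \<i> * t)" for t by (simp add: algebra_simps)
  have Q_in: "u - \<i> * t \<in> ball u r" if "t \<in> ball 0 r" for t
    using that by (simp add: dist_norm norm_mult)
  have hol_Q: "Q holomorphic_on ball 0 r"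
  proof -
    have *: "calI \<beta> holomorphic_on UNIV" if "\<beta> + 1 \<notin> \<int>\<^sub>\<le>\<^sub>0" for \<beta>
      using DERIV_calI[OF that] by (auto simp: holomorphic_on_open)
    have holc: "(\<lambda>t. calI \<beta> (t + \<i> * u)) holomorphic_on ball 0 r" if "\<beta> + 1 \<notin> \<int>\<^sub>\<le>\<^sub>0" for \<beta>
      by (rule holomorphic_on_compose_gen[OF _ *[OF that], unfolded o_def])
         (auto intro!: holomorphic_intros)
    show ?thesis
      unfolding Q_def
      by (rule holomorphic_on_divide[OF holc[OF alpha] holomorphic_on_mult[OF _ holc[OF alpha1]]])
         (use Y[OF Q_in] z[OF Q_in] Q_arg in \<open>auto intro!: holomorphic_intros\<close>)
  qed
  have "fps_nth (fps_expansion e u) k = - 2 * (1 + \<alpha>) * \<i> ^ (k + 1) * calogero_dunkl k \<alpha> (\<i> * u)"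
  proof -
    have "e (u + x) = - 2 * (1 + \<alpha>) * \<i> * Q (\<i> * x)" if x: "u + x \<in> ball u r" for x
    proof -
      have arg: "\<i> * x + \<i> * u = \<i> * (u + x)" by (simp add: algebra_simps)
      have "deriv (calI \<alpha>) (\<i> * (u + x)) = \<i> * (u + x) / (2 * (\<alpha> + 1)) * calI (\<alpha> + 1) (\<i> * (u + x))"
        by (rule DERIV_imp_deriv[OF DERIV_calI[OF alpha]])
      moreover have "- \<i> * p / (q / (2 * a) * y) = - 2 * a * \<i> * (p / (q * y))" for p q a y :: complex
        by simp
      ultimately show ?thesis
        unfolding Q_def arg e_eq[OF x] by (simp only: add.commute)
    qed
    then have "\<forall>\<^sub>F x in nhds 0. e (u + x) = - 2 * (1 + \<alpha>) * \<i> * Q (\<i> * x)"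
      using ev by (auto elim: eventually_mono)
    moreover have "(\<lambda>x. - 2 * (1 + \<alpha>) * \<i> * Q (\<i> * x)) has_fps_expansion
        fps_const (- 2 * (1 + \<alpha>) * \<i>) * fps_expansion (\<lambda>x. Q (\<i> * x)) 0"
    proof (intro has_fps_expansion_cmult_left has_fps_expansion_fps_expansion)
      show "(\<lambda>x. Q (\<i> * x)) holomorphic_on ball 0 r"
        by (rule holomorphic_on_compose_gen[OF _ hol_Q, unfolded o_def])
           (auto intro!: holomorphic_intros simp: norm_mult)
    qed (use r(1) in auto)
    ultimately have "(\<lambda>x. e (u + x)) has_fps_expansion
        fps_const (- 2 * (1 + \<alpha>) * \<i>) * fps_expansion (\<lambda>x. Q (\<i> * x)) 0"
      by (subst has_fps_expansion_cong[OF _ refl])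
    with fps_e have "fps_expansion e u = fps_const (- 2 * (1 + \<alpha>) * \<i>) * fps_expansion (\<lambda>x. Q (\<i> * x)) 0"
      by (rule fps_expansion_unique_complex)
    moreover have "(deriv ^^ k) (\<lambda>x. Q (\<i> * x)) 0 = \<i> ^ k * (deriv ^^ k) Q (\<i> * 0)"
      by (rule higher_deriv_compose_linear[OF hol_Q open_ball[of 0 r] open_ball])
         (use r(1) in \<open>auto simp: norm_mult\<close>)
    ultimately show ?thesis
      by (simp add: calogero_dunkl_def fps_expansion_def Q_def)
  qed
  then show "eta s k u = 2 * (1 + \<alpha>) *
        ((-1) ^ k / u ^ (k + 1) - \<i> ^ (k + 1) * calogero_dunkl k \<alpha> (\<i> * u))"
    unfolding eta_diff by (simp add: algebra_simps)

  have "\<forall>\<^sub>F x in nhds 0. e (u + x) * (deriv ^^ 1) (calI \<alpha>) (\<i> * (u + x))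
      = - \<i> * (deriv ^^ 0) (calI \<alpha>) (\<i> * (u + x))"
    using ev
  proof eventually_elim
    case (elim x)
    show ?case
      using deriv_calI_ne_0[OF Y[OF elim]] z[OF elim] e_eq[OF elim] by simp
  qed
  then have "fps_expansion e u * Abs_fps (\<lambda>n. \<i> ^ n * (deriv ^^ (n + 1)) (calI \<alpha>) (\<i> * u) / fact n)
      = fps_const (- \<i>) * Abs_fps (\<lambda>n. \<i> ^ n * (deriv ^^ (n + 0)) (calI \<alpha>) (\<i> * u) / fact n)"
    by (intro fps_expansion_unique_complex[OF has_fps_expansion_mult[OF fps_e has_fps_expansion_deriv_calI]])
       (subst has_fps_expansion_cong[OF _ refl], assumption,
        intro has_fps_expansion_cmult_left has_fps_expansion_deriv_calI)
  note fps_eq = this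
  have factor: "- (p * a / f) = - (a / f) * p" for p a f :: complex
    by simp
  from arg_cong[OF fps_eq, of "\<lambda>F. fps_nth F k"]
  have "(\<Sum>j=0..k. (eta s j u - (-1) ^ j * 2 * (1 + \<alpha>) / u ^ (j + 1)) *
        (\<i> ^ (k - j) * (deriv ^^ (k - j + 1)) (calI \<alpha>) (\<i> * u) / fact (k - j)))
      = - (\<i> ^ (k + 1) * (deriv ^^ k) (calI \<alpha>) (\<i> * u) / fact k)"
    unfolding fps_mult_left_const_nth fps_nth_Abs_fps fps_mult_nth[of "fps_expansion e u"] eta_diff
    by simp
  then have "(\<Sum>j=0..k. (deriv ^^ (k - j + 1)) (calI \<alpha>) (\<i> * u) / (\<i> ^ (j + 1) * fact (k - j)) *
          (eta s j u - (-1) ^ j * 2 * (1 + \<alpha>) / u ^ (j + 1))) * \<i> ^ (k + 1)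
      = - ((deriv ^^ k) (calI \<alpha>) (\<i> * u) / fact k) * \<i> ^ (k + 1)"
    unfolding recurrence_sum_rescale[of "\<lambda>n. (deriv ^^ n) (calI \<alpha>) (\<i> * u)" k]
    by (simp only: factor)
  then show "(\<Sum>j=0..k. (deriv ^^ (k - j + 1)) (calI \<alpha>) (\<i> * u) / (\<i> ^ (j + 1) * fact (k - j)) *
          (eta s j u - (-1) ^ j * 2 * (1 + \<alpha>) / u ^ (j + 1)))
        = - ((deriv ^^ k) (calI \<alpha>) (\<i> * u) / fact k)"
    by (subst (asm) mult_cancel_right) auto
qed

text \<open>Omitting the index \<open>l\<close> removes the pole 1 / (s l - z), so the corrected
  generating function is - \<i> * I / I' + 1 / (z - s l). Multiplied by (z - s l) * I' it becomes a
  power series identity, and the added I' accounts for the term with k + 2 derivatives.\<close>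

lemma calI_zero_point:
  assumes l: "l \<noteq> 0"
  shows "pv_summable (UNIV - {0, l}) (\<lambda>j. 1 / (s j - s l) ^ (k + 1))"
    and "(\<Sum>j=0..k. (deriv ^^ (k - j + 1)) (calI \<alpha>) (\<i> * s l) / (\<i> ^ (j + 1) * fact (k - j)) *
          (eta_omit s j l - (-1) ^ j * 2 * (1 + \<alpha>) / s l ^ (j + 1)))
        = (deriv ^^ (k + 2)) (calI \<alpha>) (\<i> * s l) / fact (k + 1)
          - (deriv ^^ k) (calI \<alpha>) (\<i> * s l) / fact k"
proof -
  define u where "u = s l"
  have A: "UNIV - {0} - {l} = UNIV - {0, l}" by auto
  have u0: "UNIV - {0, l} \<subseteq> UNIV - {0}" "finite (UNIV - {0} - (UNIV - {0, l}))"
    "u \<notin> s ` (UNIV - {0, l})" "u \<noteq> 0"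
    using s_inj[OF _ l] s_ne_0[OF l] by (auto simp: u_def intro: finite_subset[of _ "{l}"])
  obtain r H where r: "r > 0" "0 \<notin> ball u r"
    and nz: "\<And>z. z \<in> ball u r \<Longrightarrow> z \<noteq> u \<Longrightarrow> calI (\<alpha> + 1) (\<i> * z) \<noteq> 0"
    and H: "H holomorphic_on ball u r"
      "\<And>z. z \<in> ball u r \<Longrightarrow> pv_partial (UNIV - {0, l}) (\<lambda>j. 1 / (s j - z)) \<longlonglongrightarrow> H z"
    and lim: "\<And>k. pv_partial (UNIV - {0, l}) (\<lambda>j. 1 / (s j - u) ^ (k + 1)) \<longlonglongrightarrow> fps_nth (fps_expansion H u) k"
    by (rule pv_local[OF u0], rule that)
  show "pv_summable (UNIV - {0, l}) (\<lambda>j. 1 / (s j - s l) ^ (k + 1))"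
    unfolding pv_summable_def u_def[symmetric] using lim by (rule convergentI)
  have eta: "eta_omit s k l = fps_nth (fps_expansion H u) k" for k
    unfolding eta_omit_def pv_sum_def u_def[symmetric] using lim by (rule limI)
  define e where "e = (\<lambda>z. H z - 2 * (1 + \<alpha>) * (1 / z))"
  have eta_diff: "fps_nth (fps_expansion e u) j = eta_omit s j l - (-1) ^ j * 2 * (1 + \<alpha>) / u ^ (j + 1)" for j
    unfolding e_def eta fps_nth_expansion_diff_pole[OF H(1) r] by simp
  have hol_e: "e holomorphic_on ball u r"
    unfolding e_def using H(1) r(2) by (intro holomorphic_intros) auto
  have z: "z \<noteq> 0" if "z \<in> ball u r" for z using r(2) that by auto
  have e_eq: "e z = - \<i> * calI \<alpha> (\<i> * z) / deriv (calI \<alpha>) (\<i> * z) + 1 / (z - u)"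
    if "z \<in> ball u r" "z \<noteq> u" for z
  proof -
    have "(\<lambda>N. pv_partial (UNIV - {0}) (\<lambda>j. 1 / (s j - z)) N - 1 / (s l - z)) \<longlonglongrightarrow>
        2 * (1 + \<alpha>) / z - \<i> * calI \<alpha> (\<i> * z) / deriv (calI \<alpha>) (\<i> * z) - 1 / (s l - z)"
      by (intro tendsto_diff tendsto_const pv_log_deriv nz[OF that] z[OF that(1)])
    \<comment> \<open>The index \<open>l\<close> enters the partial sums only once N \<ge>
      \<bar>l\<bar>, hence equality eventually.\<close>
    moreover have "\<forall>\<^sub>F N in sequentially. pv_partial (UNIV - {0}) (\<lambda>j. 1 / (s j - z)) N - 1 / (s l - z)
        = pv_partial (UNIV - {0, l}) (\<lambda>j. 1 / (s j - z)) N"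
      using eventually_ge_at_top[of "nat \<bar>l\<bar>"]
      by eventually_elim (use pv_partial_remove[of l "UNIV - {0}"] l A in simp)
    ultimately have "pv_partial (UNIV - {0, l}) (\<lambda>j. 1 / (s j - z)) \<longlonglongrightarrow>
        2 * (1 + \<alpha>) / z - \<i> * calI \<alpha> (\<i> * z) / deriv (calI \<alpha>) (\<i> * z) - 1 / (s l - z)"
      by (rule Lim_transform_eventually)
    from LIMSEQ_unique[OF H(2)[OF that(1)] this]
    have "e z = - \<i> * calI \<alpha> (\<i> * z) / deriv (calI \<alpha>) (\<i> * z) - 1 / (u - z)"
      by (simp add: e_def u_def)
    moreover have "- 1 / (u - z) = 1 / (z - u)" by (metis minus_diff_eq minus_divide_divide minus_minus)
    ultimately show ?thesis by simp
  qed
  have "e analytic_on {u}"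
    using hol_e r(1) analytic_at[of e u] by (meson centre_in_ball open_ball)
  then have fps_e: "(\<lambda>x. e (u + x)) has_fps_expansion fps_expansion e u"
    by (rule analytic_at_imp_has_fps_expansion)
  have ev: "\<forall>\<^sub>F x in nhds 0. u + x \<in> ball u r"
    using r(1) eventually_nhds_in_open[of "ball 0 r" "0::complex"] by (simp add: dist_norm)
  have dX: "deriv (calI \<alpha>) (\<i> * u) = 0"
    using calI_zero_iff[of u] l by (auto simp: u_def DERIV_imp_deriv[OF DERIV_calI[OF alpha]])
  \<comment> \<open>The factor \<open>x\<close> clears the pole, so that the identity also holds at \<open>x = 0\<close>.\<close>
  have "\<forall>\<^sub>F x in nhds 0. x * (e (u + x) * (deriv ^^ 1) (calI \<alpha>) (\<i> * (u + x)))
      = - \<i> * (x * (deriv ^^ 0) (calI \<alpha>) (\<i> * (u + x))) + (deriv ^^ 1) (calI \<alpha>) (\<i> * (u + x))"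
    using ev
  proof eventually_elim
    case (elim x)
    show ?case
    proof (cases "x = 0")
      case False
      then have "deriv (calI \<alpha>) (\<i> * (u + x)) \<noteq> 0"
        using deriv_calI_ne_0[OF nz[OF elim]] z[OF elim] by simp
      then show ?thesis
        using e_eq[OF elim] False by (simp add: field_simps)
    qed (use dX in simp)
  qed
  then have "fps_X * (fps_expansion e u * Abs_fps (\<lambda>n. \<i> ^ n * (deriv ^^ (n + 1)) (calI \<alpha>) (\<i> * u) / fact n))
      = fps_const (- \<i>) * (fps_X * Abs_fps (\<lambda>n. \<i> ^ n * (deriv ^^ (n + 0)) (calI \<alpha>) (\<i> * u) / fact n))
        + Abs_fps (\<lambda>n. \<i> ^ n * (deriv ^^ (n + 1)) (calI \<alpha>) (\<i> * u) / fact n)"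
    by (intro fps_expansion_unique_complex[OF has_fps_expansion_mult[OF has_fps_expansion_fps_X
          has_fps_expansion_mult[OF fps_e has_fps_expansion_deriv_calI]]])
       (subst has_fps_expansion_cong[OF _ refl], assumption,
        intro has_fps_expansion_add has_fps_expansion_mult has_fps_expansion_fps_X
          has_fps_expansion_cmult_left has_fps_expansion_deriv_calI)
  note fps_eq = this
  have factor: "- (p * a / f) + p * b / g = (b / g - a / f) * p" for p a b f g :: complex
    by (simp add: algebra_simps)
  \<comment> \<open>The factor \<open>fps_X\<close> shifts indices: coefficient k + 1 pairs
    coefficient k of the product with coefficient k + 1 of the derivative series.\<close>
  from arg_cong[OF fps_eq, of "\<lambda>F. fps_nth F (Suc k)"]
  have "(\<Sum>j=0..k. (eta_omit s j l - (-1) ^ j * 2 * (1 + \<alpha>) / u ^ (j + 1)) *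
        (\<i> ^ (k - j) * (deriv ^^ (k - j + 1)) (calI \<alpha>) (\<i> * u) / fact (k - j)))
      = - (\<i> ^ (k + 1) * (deriv ^^ k) (calI \<alpha>) (\<i> * u) / fact k)
        + \<i> ^ (k + 1) * (deriv ^^ (k + 2)) (calI \<alpha>) (\<i> * u) / fact (k + 1)"
    unfolding fps_add_nth fps_mult_left_const_nth fps_X_mult_nth fps_nth_Abs_fps
    by (simp add: fps_mult_nth eta_diff)
  then have "(\<Sum>j=0..k. (deriv ^^ (k - j + 1)) (calI \<alpha>) (\<i> * u) / (\<i> ^ (j + 1) * fact (k - j)) *
          (eta_omit s j l - (-1) ^ j * 2 * (1 + \<alpha>) / u ^ (j + 1))) * \<i> ^ (k + 1)
      = ((deriv ^^ (k + 2)) (calI \<alpha>) (\<i> * u) / fact (k + 1)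
          - (deriv ^^ k) (calI \<alpha>) (\<i> * u) / fact k) * \<i> ^ (k + 1)"
    unfolding recurrence_sum_rescale[of "\<lambda>n. (deriv ^^ n) (calI \<alpha>) (\<i> * u)" k]
    by (simp only: factor)
  then show "(\<Sum>j=0..k. (deriv ^^ (k - j + 1)) (calI \<alpha>) (\<i> * s l) / (\<i> ^ (j + 1) * fact (k - j)) *
          (eta_omit s j l - (-1) ^ j * 2 * (1 + \<alpha>) / s l ^ (j + 1)))
        = (deriv ^^ (k + 2)) (calI \<alpha>) (\<i> * s l) / fact (k + 1)
          - (deriv ^^ k) (calI \<alpha>) (\<i> * s l) / fact k"
    unfolding u_def by (subst (asm) mult_cancel_right) auto
qed

section \<open>The modified Bessel equation and the two closed forms\<close>

lemma DERIV_higher_deriv_calI: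
  "((deriv ^^ n) (calI \<alpha>) has_field_derivative (deriv ^^ Suc n) (calI \<alpha>) z) (at z)"
  using holomorphic_derivI[of "(deriv ^^ n) (calI \<alpha>)" UNIV z]
    holomorphic_higher_deriv[OF holomorphic_calI open_UNIV, of n] by simp

text \<open>Both claims rest on the product rule applied to z / (2 * (\<alpha> + 1)) times
  \<open>calI (\<alpha> + 1)\<close>, which is the first derivative; the contiguous relation then
  gives the modified Bessel equation. The second formula serves to show that the second derivative
  is nonzero at a Bessel zero.\<close>

lemma calI_ode:
  "z * (deriv ^^ 2) (calI \<alpha>) z + (2 * \<alpha> + 1) * deriv (calI \<alpha>) z = z * calI \<alpha> z"
  and deriv2_calI: "(deriv ^^ 2) (calI \<alpha>) z
    = calI (\<alpha> + 1) z / (2 * (\<alpha> + 1)) + z / (2 * (\<alpha> + 1)) * deriv (calI (\<alpha> + 1)) z"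
proof -
  let ?Y = "calI (\<alpha> + 1)"
  have d: "deriv (calI \<alpha>) = (\<lambda>z. z / (2 * (\<alpha> + 1)) * ?Y z)"
    using DERIV_imp_deriv[OF DERIV_calI[OF alpha]] by blast
  have "(?Y has_field_derivative deriv ?Y z) (at z)"
    using DERIV_calI[OF alpha1] DERIV_imp_deriv by metis
  then have "((\<lambda>z. z / (2 * (\<alpha> + 1)) * ?Y z) has_field_derivative
      ?Y z / (2 * (\<alpha> + 1)) + z / (2 * (\<alpha> + 1)) * deriv ?Y z) (at z)"
    using DERIV_mult[OF DERIV_cdivide[OF DERIV_ident, of "2 * (\<alpha> + 1)"]]
    by (fastforce simp: mult.commute simp del: distrib_left_numeral)
  then show d2: "(deriv ^^ 2) (calI \<alpha>) z = ?Y z / (2 * (\<alpha> + 1)) + z / (2 * (\<alpha> + 1)) * deriv ?Y z"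
    by (simp only: numeral_2_eq_2 funpow.simps o_def id_apply d) (rule DERIV_imp_deriv)
  have "z * (y / (2 * a) + z / (2 * a) * y') + (2 * a - 1) * (z / (2 * a) * y)
      = z * (y + z / (2 * a) * y')" if "a \<noteq> 0" for a y y'
    using that by (simp add: field_simps)
  note eq = this[OF alpha_ne, of "?Y z" "deriv ?Y z"]
  have "2 * (\<alpha> + 1) - 1 = 2 * \<alpha> + 1" by simp
  with eq
  show "z * (deriv ^^ 2) (calI \<alpha>) z + (2 * \<alpha> + 1) * deriv (calI \<alpha>) z = z * calI \<alpha> z"
    unfolding d2 calI_contiguous[OF alpha, of z] fun_cong[OF d, of z] by (simp only:)
qed

lemma calI_ode_derivs:
  defines "D \<equiv> \<lambda>n. (deriv ^^ n) (calI \<alpha>)"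
  shows "z * D 3 z + (2 * \<alpha> + 2) * D 2 z = D 0 z + z * D 1 z"
    and "z * D 4 z + (2 * \<alpha> + 3) * D 3 z = 2 * D 1 z + z * D 2 z"
proof -
  have [derivative_intros]: "(D n has_field_derivative D (Suc n) z) (at z)" for n z
    unfolding D_def by (rule DERIV_higher_deriv_calI)
  have ode: "(\<lambda>z. z * D 2 z + (2 * \<alpha> + 1) * D 1 z) = (\<lambda>z. z * D 0 z)"
    unfolding D_def using calI_ode by simp
  have "((\<lambda>z. z * D 2 z + (2 * \<alpha> + 1) * D 1 z) has_field_derivative
      z * D 3 z + (2 * \<alpha> + 2) * D 2 z) (at z)" for z
    by (auto intro!: derivative_eq_intros simp: numeral_eq_Suc algebra_simps)
  moreover have "((\<lambda>z. z * D 0 z) has_field_derivative D 0 z + z * D 1 z) (at z)" for z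
    by (auto intro!: derivative_eq_intros simp: numeral_eq_Suc algebra_simps)
  ultimately have ode': "z * D 3 z + (2 * \<alpha> + 2) * D 2 z = D 0 z + z * D 1 z" for z
    unfolding ode by (rule DERIV_unique)
  then show "z * D 3 z + (2 * \<alpha> + 2) * D 2 z = D 0 z + z * D 1 z" .
  have "((\<lambda>z. z * D 3 z + (2 * \<alpha> + 2) * D 2 z) has_field_derivative
      z * D 4 z + (2 * \<alpha> + 3) * D 3 z) (at z)"
    by (auto intro!: derivative_eq_intros simp: numeral_eq_Suc algebra_simps)
  moreover have "((\<lambda>z. D 0 z + z * D 1 z) has_field_derivative 2 * D 1 z + z * D 2 z) (at z)"
    by (auto intro!: derivative_eq_intros simp: numeral_eq_Suc algebra_simps)
  ultimately show "z * D 4 z + (2 * \<alpha> + 3) * D 3 z = 2 * D 1 z + z * D 2 z"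
    unfolding ode' by (rule DERIV_unique)
qed

text \<open>At \<i> * s l the first derivative vanishes, so in recurrence k the term j = k drops
  out: k = 1 determines the sum with index 0 and k = 2 the one with index 1, while k = 0 only says
  that \<open>D 0 = D 2\<close>.\<close>

lemma eta_omit_0_1:
  assumes l: "l \<noteq> 0"
  shows "eta_omit s 0 l = (3 + 2 * \<alpha>) / (2 * s l)"
    and "eta_omit s 1 l = - ((3 + 2 * \<alpha>) * (7 + 2 * \<alpha>) / (12 * (s l)\<^sup>2)) + 1 / 3"
proof -
  define u where "u = s l"
  define D where "D = (\<lambda>n. (deriv ^^ n) (calI \<alpha>) (\<i> * u))"
  have "u \<noteq> 0" using s_ne_0[OF l] by (simp add: u_def)
  have Y: "calI (\<alpha> + 1) (\<i> * u) = 0"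
    using calI_zero_iff[of u] l by (auto simp: u_def)
  have D1: "D 1 = 0"
    using Y by (simp add: D_def DERIV_imp_deriv[OF DERIV_calI[OF alpha]])
  \<comment> \<open>At a Bessel zero the second derivative is a nonzero multiple of
    \<open>calI (\<alpha> + 1 + 1)\<close>, which is nonzero there by simplicity of the
    hypergeometric zeros.\<close>
  have D2: "D 2 \<noteq> 0"
  proof -
    have "calI (\<alpha> + 1 + 1) (\<i> * u) \<noteq> 0"
      using hyp01_zero_simple[OF alpha1] Y
      unfolding calI_eq_hyp01[OF alpha1] calI_eq_hyp01[OF plus_1_notin_nonpos_Ints[OF alpha1]] .
    moreover have "\<alpha> + 1 + 1 \<noteq> 0" using alpha1 by auto
    ultimately show ?thesis
      unfolding D_def deriv2_calI Y DERIV_imp_deriv[OF DERIV_calI[OF alpha1]]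
      using \<open>u \<noteq> 0\<close> alpha_ne by (simp del: distrib_left_numeral)
  qed
  have D0: "D 0 = D 2"
    using calI_ode[of "\<i> * u"] D1 \<open>u \<noteq> 0\<close> by (simp add: D_def)
  have "\<i> * u * D 3 + (2 * \<alpha> + 2) * D 2 = D 0 + \<i> * u * D 1"
    unfolding D_def by (rule calI_ode_derivs(1))
  then have "\<i> * u * D 3 = D 2 - (2 * \<alpha> + 2) * D 2"
    unfolding D0 D1 by (simp only: eq_diff_eq mult_zero_right add_0_right)
  then have D3: "\<i> * u * D 3 = - (2 * \<alpha> + 1) * D 2"
    by (simp only:) (simp add: algebra_simps)
  have "\<i> * u * D 4 + (2 * \<alpha> + 3) * D 3 = 2 * D 1 + \<i> * u * D 2"
    unfolding D_def by (rule calI_ode_derivs(2))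
  then have D4: "\<i> * u * D 4 = \<i> * u * D 2 - (2 * \<alpha> + 3) * D 3"
    unfolding D1 by (simp only: eq_diff_eq mult_zero_right add_0_left)
  define c where "c = (\<lambda>j. eta_omit s j l - (-1) ^ j * 2 * (1 + \<alpha>) / u ^ (j + 1))"
  have rec: "(\<Sum>j=0..k. D (k - j + 1) / (\<i> ^ (j + 1) * fact (k - j)) * c j)
        = D (k + 2) / fact (k + 1) - D k / fact k" for k
    using calI_zero_point(2)[OF l, of k] unfolding c_def D_def u_def .
  have r1: "D 2 / \<i> * c 0 = D 3 / 2"
    using rec[of 1] D1 by (simp add: numeral_eq_Suc mult_ac)
  have r2: "D 3 / (2 * \<i>) * c 0 - D 2 * c 1 = D 4 / 6 - D 2 / 2"
    using rec[of 2] D1 by (simp add: numeral_eq_Suc mult_ac)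
  note cs = bessel_zero_algebra[OF \<open>u \<noteq> 0\<close> D2 D3 D4 r1 r2]
  have "eta_omit s 0 l = c 0 + 2 * (1 + \<alpha>) / u" by (simp add: c_def)
  then have "2 * u * eta_omit s 0 l = 2 * u * c 0 + 4 * (1 + \<alpha>)"
    using \<open>u \<noteq> 0\<close> by (simp only: distrib_left) simp
  then have "2 * u * eta_omit s 0 l = 3 + 2 * \<alpha>"
    unfolding cs(1) by (simp add: algebra_simps)
  then show "eta_omit s 0 l = (3 + 2 * \<alpha>) / (2 * s l)"
    using \<open>u \<noteq> 0\<close> by (simp add: u_def nonzero_eq_divide_eq mult_ac)
  have "eta_omit s 1 l = c 1 - 2 * (1 + \<alpha>) / u\<^sup>2" by (simp add: c_def power2_eq_square add_divide_distrib diff_divide_distrib)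
  then have "12 * u\<^sup>2 * eta_omit s 1 l = 12 * u\<^sup>2 * c 1 - 24 * (1 + \<alpha>)"
    using \<open>u \<noteq> 0\<close> by (simp only: right_diff_distrib) simp
  then have "12 * u\<^sup>2 * eta_omit s 1 l = 4 * u\<^sup>2 - (3 + 2 * \<alpha>) * (7 + 2 * \<alpha>)"
    unfolding cs(2) by (simp add: algebra_simps)
  then have "eta_omit s 1 l = (4 * u\<^sup>2 - (3 + 2 * \<alpha>) * (7 + 2 * \<alpha>)) / (12 * u\<^sup>2)"
    using \<open>u \<noteq> 0\<close> by (intro eq_divide_imp) (simp_all add: mult.commute)
  then show "eta_omit s 1 l = - ((3 + 2 * \<alpha>) * (7 + 2 * \<alpha>) / (12 * (s l)\<^sup>2)) + 1 / 3"
    using \<open>u \<noteq> 0\<close> unfolding u_def[symmetric] by (simp only: diff_divide_distrib) simp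
qed

end

theorem theorem4p3:
  fixes \<alpha> u :: complex and k :: nat and l :: int and s :: "int \<Rightarrow> complex"
  assumes alpha: "\<And>n::nat. n \<ge> 1 \<Longrightarrow> \<alpha> \<noteq> - of_nat n"
    and s: "bessel_zero_enum \<alpha> s"
    and u: "u \<notin> insert 0 (s ` (UNIV - {0}))"
    and l: "l \<noteq> 0"
  shows "pv_summable (UNIV - {0}) (\<lambda>j. 1 / (s j - u) ^ (k + 1))
    \<and> pv_summable (UNIV - {0, l}) (\<lambda>j. 1 / (s j - s l) ^ (k + 1))
    \<and> eta s k u = 2 * (1 + \<alpha>) *
        ((-1) ^ k / u ^ (k + 1) - \<i> ^ (k + 1) * calogero_dunkl k \<alpha> (\<i> * u))
    \<and> (\<Sum>j=0..k. (deriv ^^ (k - j + 1)) (calI \<alpha>) (\<i> * u) / (\<i> ^ (j + 1) * fact (k - j)) *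
          (eta s j u - (-1) ^ j * 2 * (1 + \<alpha>) / u ^ (j + 1)))
        = - ((deriv ^^ k) (calI \<alpha>) (\<i> * u) / fact k)
    \<and> (\<Sum>j=0..k. (deriv ^^ (k - j + 1)) (calI \<alpha>) (\<i> * s l) / (\<i> ^ (j + 1) * fact (k - j)) *
          (eta_omit s j l - (-1) ^ j * 2 * (1 + \<alpha>) / s l ^ (j + 1)))
        = (deriv ^^ (k + 2)) (calI \<alpha>) (\<i> * s l) / fact (k + 1)
          - (deriv ^^ k) (calI \<alpha>) (\<i> * s l) / fact k
    \<and> eta_omit s 0 l = (3 + 2 * \<alpha>) / (2 * s l)
    \<and> eta_omit s 1 l = - ((3 + 2 * \<alpha>) * (7 + 2 * \<alpha>) / (12 * (s l)\<^sup>2)) + 1 / 3"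
proof -
  \<comment> \<open>The excluded values -1, -2, ... of \<alpha> are those for which \<alpha> + 1 is
    a nonpositive integer, hence the shift to \<open>Suc n\<close>.\<close>
  have "\<alpha> + 1 \<notin> \<int>\<^sub>\<le>\<^sub>0"
  proof
    assume "\<alpha> + 1 \<in> \<int>\<^sub>\<le>\<^sub>0"
    then obtain n where "\<alpha> + 1 = - of_nat n" by (elim nonpos_Ints_cases')
    then have "\<alpha> = - of_nat n - 1" by (simp only: eq_diff_eq)
    then have "\<alpha> = - of_nat (Suc n)" by simp
    with alpha[of "Suc n"] show False by simp
  qed
  then interpret bessel_zeros \<alpha> s
    using s by unfold_locales
  show ?thesis
    by (intro conjI calI_regular_point[OF u] calI_zero_point[OF l] eta_omit_0_1[OF l])
qed

end
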